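(* Fix $\alpha\in(1,\infty)$, $p\ge n$, $\beta_0\in\mathbb{R}^p$ and $\lambda>0$, and let $y=X\beta_0+\varepsilon$, where $\varepsilon\in\mathbb{R}^n$ is random with i.i.d. components of mean zero and variance $\sigma^2$, such that $\varepsilon/\sqrt{n}$ has a density $g_n$ on $\mathbb{R}^n$. Suppose that Assumptions 1 and 2 (stated in the context) hold. Then the distribution of the augmented estimator $(\hat\gamma_{\mathcal A},S,\mathcal A)$ is given, for $(r_A,s,A)\in\Omega$, by the differential form of order $n$ $$d\mu_A:=\mathbb{P}(dr_A,ds,\{A\})=f_A(r_A,s)\,d\theta,\qquad f_A(r_A,s)=g_n\big(\tilde H_A(r_A,s;\beta_0,\lambda)\big)\,|J_A(r_A,s;\lambda)|,\qquad \theta=(r_A,s_F)\in\mathbb{R}^n .$$ Explicitly: for every $A\subset\{1,\dots,J\}$ with $|A|\le n$, every Borel set $\Gamma\subset(0,\infty)^{|A|}$, every relatively open $\Phi_0\subset\mathcal{M}_A$ parameterized by $s_F$ with inverse parameterization $s(\cdot)$, and every Borel set $\Delta\subset\{s_F:s\in\Phi_0\}$, with $\Phi=\{s(u):u\in\Delta\}$, $$\mathbb{P}(\hat\gamma_A\in\Gamma,\ S\in\Phi,\ \mathcal A=A)=\int_\Gamma\int_\Delta f_A(r_A,s(u))\,du\,dr_A .$$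
   Context: Setup. $X\in\mathbb{R}^{n\times p}$; $\{1,\dots,p\}$ is partitioned into nonempty groups $\mathcal{G}_1,\dots,\mathcal{G}_J$, $p_j=|\mathcal{G}_j|$. For $v\in\mathbb{R}^p$, $v_{(j)}=(v_k)_{k\in\mathcal{G}_j}$; for a matrix $M$ with $p$ columns, $M_{(j)}$ is the submatrix of the columns in $\mathcal{G}_j$. Weights $w_j>0$, $W=\mathrm{diag}(w_1 I_{p_1},\dots,w_J I_{p_J})$ (the diagonal matrix with entry $w_j$ at indices in $\mathcal{G}_j$). $\Psi=\frac1n X^{\mathsf T}X$. $M^+$ is the Moore–Penrose pseudo-inverse. $\alpha^*$ satisfies $1/\alpha+1/\alpha^*=1$, $\rho=\alpha^*/\alpha$, $\eta(x)=\mathrm{sgn}(x)|x|^\rho$ for $x\in[-1,1]$, $\eta'(x)=\rho|x|^{\rho-1}$ (with the convention $\eta'(0)=0$ if $\rho<1$); $\eta$ is applied to vectors componentwise. Block Lasso: $\hat\beta\in\arg\min_{\beta\in\mathbb{R}^p}\{\frac1{2n}\|y-X\beta\|^2+\lambda\sum_{j=1}^J w_j\|\beta_{(j)}\|_\alpha\}$. The subgradient vector $S\in\mathbb{R}^p$ is defined by $\frac1nX^{\mathsf T}X\hat\beta+\lambda WS=\frac1nX^{\mathsf T}y$; it satisfies $S_{(j)}\in\partial\|\cdot\|_\alpha(\hat\beta_{(j)})$, and $\hat\beta_{(j)}=\|\hat\beta_{(j)}\|_\alpha\,\eta(S_{(j)})$ whenever $\hat\beta_{(j)}\neq0$. Put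 $\hat\gamma_j=\|\hat\beta_{(j)}\|_\alpha$ and $\mathcal A=\{j:\hat\beta_{(j)}\ne0\}$. The augmented estimator $(\hat\beta,S)$ is represented by $(\hat\gamma_{\mathcal A},S,\mathcal A)$, where $\hat\gamma_A=(\hat\gamma_j)_{j\in A}$. Under Assumptions 1 and 2, $\hat\beta$ is unique and $|\mathcal A|\le n$ for every $y$. Assumption 1: every $\min(n,p)$ columns of $X$ are linearly independent. Assumption 2: (a) $p_j\le n$ for all $j$; (b) the columns of $M=XW^{-1}$ are in blockwise general position: for every $s\in\mathrm{row}(M)$, the family of vectors $M_{(j)}\eta(s_{(j)})$, $j\in\mathcal E=\{j:\|s_{(j)}\|_{\alpha^*}=1\}$, is in general position, i.e. for every $k<n$ no $k$-dimensional affine subspace of $\mathbb{R}^n$ contains more than $k+1$ members of the family. Sample space. $\mathcal V=\mathrm{row}(XW^{-1})$ (row space). For $A\subset\{1,\dots,J\}$, $|A|\le n$: $\mathcal M_A=\{s\in\mathcal V:\|s_{(j)}\|_{\alpha^*}=1\ \forall j\in A,\ \|s_{(j)}\|_{\alpha^*}\le1\ \forall j\notin A\}$, $\Omega_A=(0,\infty)^{|A|}\times\mathcal M_A$, $\Omega=\bigcup_{|A|\le n}\Omega_A\times\{A\}$. A point $(r_A,s)\in\Omega_A$ is extended by $r_j=0$ for $j\notin A$. Parameterization. Let $F\subset\{1,\dots,p\}$ with $|F|=n-|A|$. A relatively open $\Phi_0\subset\mathcal M_A$ is parameterized by $s_F=(s_k)_{k\in F}$ if $s\mapsto s_F$ is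 injective on $\Phi_0$ with open image in $\mathbb{R}^{n-|A|}$ and its inverse $u\mapsto s(u)$ is $C^1$; $T=T(\eta(s),A)\in\mathbb{R}^{p\times(n-|A|)}$ denotes the derivative matrix of this inverse, so $ds=T\,ds_F$. (If $|A|=n$, $F=\varnothing$, $\Phi_0$ is a point, $T$ is empty and the integral over $\Delta$ is evaluation.) Mapping and Jacobian. $\tilde H_A(r_A,s;\beta_0,\lambda)=\sqrt n\,(X^{\mathsf T})^+\big[\sum_{j\in A}r_j\Psi_{(j)}\eta(s_{(j)})+\lambda Ws-\Psi\beta_0\big]\in\mathbb{R}^n$. Let $r\circ\Psi=[r_1\Psi_{(1)}|\cdots|r_J\Psi_{(J)}]\in\mathbb{R}^{p\times p}$ (the block $r_j\Psi_{(j)}$ occupying the columns in $\mathcal{G}_j$), let $(\Psi\circ\eta)_A$ be the $p\times|A|$ matrix with columns $\Psi_{(j)}\eta(s_{(j)})$, $j\in A$, and let $D=D(s,A)$ be the $p\times p$ diagonal matrix with $D_{kk}=\eta'(s_k)$ for $k\in\bigcup_{j\in A}\mathcal{G}_j$ and $D_{kk}=0$ otherwise. Put $M(r_A,s,A;\lambda)=[(\Psi\circ\eta)_A\mid\{(r\circ\Psi)D+\lambda W\}T]\in\mathbb{R}^{p\times n}$ and $J_A(r_A,s;\lambda)=\det[\sqrt n\,(X^{\mathsf T})^+M(r_A,s,A;\lambda)]$. *)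

theory Defs
  imports "HOL-Probability.Probability"
begin

text \<open>
  Conventions. The design matrix is \<open>X :: real^'p^'n\<close>, so \<open>n = CARD('n)\<close> and \<open>p = CARD('p)\<close>.
  A partition of the covariates into nonempty groups labelled by \<open>'j\<close> is a surjective map
  \<open>grp :: 'p \<Rightarrow> 'j\<close>. A vector indexed by a subset \<open>A\<close> of a finite type, such as the active norms
  \<open>r\<^sub>A\<close> or the coordinates \<open>s\<^sub>F\<close>, is represented by its extension by zero outside \<open>A\<close>; thus
  $\mathbb{R}^A$ is the subspace \<open>coord_space A\<close>.
\<close>

definition coord_space :: "'k::finite set \<Rightarrow> (real^'k) set" where
  "coord_space F = {v. \<forall>k. k \<notin> F \<longrightarrow> v $ k = 0}"

definition coords :: "'k::finite set \<Rightarrow> real^'k \<Rightarrow> real^'k" where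
  "coords F v = (\<chi> k. if k \<in> F then v $ k else 0)"

text \<open>Lebesgue measure on \<open>coord_space F\<close>; for \<open>F = {}\<close> it is the unit point mass at \<open>0\<close>.\<close>

definition coord_lborel :: "'k::finite set \<Rightarrow> (real^'k) measure" where
  "coord_lborel F = distr (\<Pi>\<^sub>M k\<in>F. lborel) borel (\<lambda>u. \<chi> k. if k \<in> F then u k else 0)"

definition pos_orthant :: "'k::finite set \<Rightarrow> (real^'k) set" where
  "pos_orthant A = {r \<in> coord_space A. \<forall>j\<in>A. 0 < r $ j}"

definition is_moore_penrose :: "real^'b^'a \<Rightarrow> real^'a^'b \<Rightarrow> bool" where
  "is_moore_penrose A B \<longleftrightarrow>
     A ** B ** A = A \<and> B ** A ** B = B \<and>
     transpose (A ** B) = A ** B \<and> transpose (B ** A) = B ** A"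

definition pinv :: "real^'b^'a \<Rightarrow> real^'a^'b" where
  "pinv A = (THE B. is_moore_penrose A B)"

definition row_space :: "real^'b^'a \<Rightarrow> (real^'b) set" where
  "row_space A = span (rows A)"

definition gram :: "real^'p^'n \<Rightarrow> real^'p^'p" where
  "gram X = (1 / real CARD('n)) *\<^sub>R (transpose X ** X)"

definition weight_matrix :: "('p::finite \<Rightarrow> 'j) \<Rightarrow> ('j \<Rightarrow> real) \<Rightarrow> real^'p^'p" where
  "weight_matrix grp w = (\<chi> i k. if i = k then w (grp k) else 0)"

definition block :: "('p::finite \<Rightarrow> 'j) \<Rightarrow> 'j \<Rightarrow> 'p set" where
  "block grp j = {k. grp k = j}"

definition block_norm :: "('p::finite \<Rightarrow> 'j) \<Rightarrow> real \<Rightarrow> 'j \<Rightarrow> real^'p \<Rightarrow> real" where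
  "block_norm grp a j v = (\<Sum>k\<in>block grp j. \<bar>v $ k\<bar> powr a) powr (1 / a)"

text \<open>The product $M_{(j)} v_{(j)}$.\<close>

definition block_mult :: "('p::finite \<Rightarrow> 'j) \<Rightarrow> real^'p^'m \<Rightarrow> 'j \<Rightarrow> real^'p \<Rightarrow> real^'m" where
  "block_mult grp M j v = (\<Sum>k\<in>block grp j. v $ k *\<^sub>R column k M)"

definition block_lasso_objective ::
  "real^'p^'n \<Rightarrow> ('p \<Rightarrow> 'j::finite) \<Rightarrow> ('j \<Rightarrow> real) \<Rightarrow> real \<Rightarrow> real \<Rightarrow> real^'n \<Rightarrow> real^'p \<Rightarrow> real" where
  "block_lasso_objective X grp w \<alpha> lam y \<beta> =
     1 / (2 * real CARD('n)) * (norm (y - X *v \<beta>))\<^sup>2 + lam * (\<Sum>j\<in>UNIV. w j * block_norm grp \<alpha> j \<beta>)"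

definition block_norms :: "('p::finite \<Rightarrow> 'j::finite) \<Rightarrow> real \<Rightarrow> real^'p \<Rightarrow> real^'j" where
  "block_norms grp \<alpha> \<beta> = (\<chi> j. block_norm grp \<alpha> j \<beta>)"

definition active_set :: "('p::finite \<Rightarrow> 'j) \<Rightarrow> real^'p \<Rightarrow> 'j set" where
  "active_set grp \<beta> = {j. \<exists>k\<in>block grp j. \<beta> $ k \<noteq> 0}"

definition eta :: "real \<Rightarrow> real \<Rightarrow> real" where
  "eta \<rho> x = sgn x * \<bar>x\<bar> powr \<rho>"

definition eta_vec :: "real \<Rightarrow> real^'p \<Rightarrow> real^'p" where
  "eta_vec \<rho> v = (\<chi> k. eta \<rho> (v $ k))"

text \<open>
  At \<open>0\<close> the formula \<open>\<rho> * \<bar>x\<bar> powr (\<rho> - 1)\<close> has to be read with $0^0 = 1$ if \<open>\<rho> = 1\<close>, whereas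
  \<open>0 powr 0 = 0\<close> in HOL; for \<open>\<rho> < 1\<close> the value \<open>0\<close> is a convention.
\<close>

definition eta_deriv :: "real \<Rightarrow> real \<Rightarrow> real" where
  "eta_deriv \<rho> x = (if x = 0 then (if \<rho> = 1 then 1 else 0) else \<rho> * \<bar>x\<bar> powr (\<rho> - 1))"

definition columns_independent :: "real^'p^'n \<Rightarrow> bool" where
  "columns_independent X \<longleftrightarrow>
     (\<forall>C. card C = min CARD('n) CARD('p) \<longrightarrow>
        inj_on (\<lambda>k. column k X) C \<and> independent ((\<lambda>k. column k X) ` C))"

text \<open>General position of a family: members are counted by index.\<close>

definition general_position :: "'j::finite set \<Rightarrow> ('j \<Rightarrow> real^'n) \<Rightarrow> bool" where
  "general_position E v \<longleftrightarrow>
     (\<forall>k<CARD('n). \<forall>P. affine P \<and> aff_dim P = int k \<longrightarrow> card {j\<in>E. v j \<in> P} \<le> k + 1)"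

definition blockwise_general_position ::
  "real^'p^'n \<Rightarrow> ('p \<Rightarrow> 'j::finite) \<Rightarrow> real \<Rightarrow> real \<Rightarrow> bool" where
  "blockwise_general_position M grp \<alpha>s \<rho> \<longleftrightarrow>
     (\<forall>s\<in>row_space M.
        general_position {j. block_norm grp \<alpha>s j s = 1} (\<lambda>j. block_mult grp M j (eta_vec \<rho> s)))"

definition subgrad_set ::
  "real^'p^'n \<Rightarrow> ('p \<Rightarrow> 'j) \<Rightarrow> ('j \<Rightarrow> real) \<Rightarrow> real \<Rightarrow> 'j set \<Rightarrow> (real^'p) set" where
  "subgrad_set X grp w \<alpha>s A =
     {s \<in> row_space (X ** matrix_inv (weight_matrix grp w)).
        (\<forall>j\<in>A. block_norm grp \<alpha>s j s = 1) \<and> (\<forall>j. j \<notin> A \<longrightarrow> block_norm grp \<alpha>s j s \<le> 1)}"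

text \<open>
  \<open>\<sigma>\<close> is the inverse of \<open>s \<mapsto> s\<^sub>F\<close> on \<open>\<Phi>\<^sub>0\<close>, and \<open>T s\<close> is its derivative matrix at \<open>s\<^sub>F\<close>.
  Only the columns of \<open>T s\<close> with index in \<open>F\<close> are meaningful; the remaining ones are set to zero.
  The derivative is taken within the open subset \<open>coords F ` \<Phi>\<^sub>0\<close> of \<open>coord_space F\<close>.
\<close>

definition parameterized_by ::
  "'p::finite set \<Rightarrow> (real^'p) set \<Rightarrow> (real^'p \<Rightarrow> real^'p) \<Rightarrow> (real^'p \<Rightarrow> real^'p^'p) \<Rightarrow> bool" where
  "parameterized_by F \<Phi>\<^sub>0 \<sigma> T \<longleftrightarrow>
     inj_on (coords F) \<Phi>\<^sub>0 \<and>
     openin (top_of_set (coord_space F)) (coords F ` \<Phi>\<^sub>0) \<and>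
     (\<forall>s\<in>\<Phi>\<^sub>0. \<sigma> (coords F s) = s) \<and>
     (\<forall>u\<in>coords F ` \<Phi>\<^sub>0.
        (\<sigma> has_derivative (\<lambda>h. T (\<sigma> u) *v h)) (at u within coords F ` \<Phi>\<^sub>0)) \<and>
     continuous_on (coords F ` \<Phi>\<^sub>0) (\<lambda>u. T (\<sigma> u)) \<and>
     (\<forall>s\<in>\<Phi>\<^sub>0. \<forall>k. k \<notin> F \<longrightarrow> column k (T s) = 0)"

definition H_map ::
  "real^'p^'n \<Rightarrow> ('p \<Rightarrow> 'j::finite) \<Rightarrow> ('j \<Rightarrow> real) \<Rightarrow> real \<Rightarrow> 'j set \<Rightarrow> real^'p \<Rightarrow> real \<Rightarrow>
     real^'j \<Rightarrow> real^'p \<Rightarrow> real^'n" where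
  "H_map X grp w \<rho> A \<beta>\<^sub>0 lam r s =
     sqrt (real CARD('n)) *\<^sub>R (pinv (transpose X) *v
       ((\<Sum>j\<in>A. r $ j *\<^sub>R block_mult grp (gram X) j (eta_vec \<rho> s))
        + lam *\<^sub>R (weight_matrix grp w *v s) - gram X *v \<beta>\<^sub>0))"

definition scaled_gram :: "real^'p^'n \<Rightarrow> ('p \<Rightarrow> 'j::finite) \<Rightarrow> real^'j \<Rightarrow> real^'p^'p" where
  "scaled_gram X grp r = (\<chi> i k. r $ grp k * gram X $ i $ k)"

definition D_matrix :: "('p::finite \<Rightarrow> 'j) \<Rightarrow> real \<Rightarrow> 'j set \<Rightarrow> real^'p \<Rightarrow> real^'p^'p" where
  "D_matrix grp \<rho> A s = (\<chi> i k. if i = k \<and> grp k \<in> A then eta_deriv \<rho> (s $ k) else 0)"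

text \<open>
  The matrix $M(r_A,s,A;\lambda)$ has one column for each \<open>j \<in> A\<close> and one for each \<open>k \<in> F\<close>.
  To be a matrix with columns indexed by \<open>'n\<close> it needs an enumeration
  \<open>e\<close> of \<open>A <+> F\<close> by \<open>'n\<close>; changing \<open>e\<close> permutes the columns and so affects at most the sign
  of the Jacobian. \<open>Ts\<close> is the derivative matrix at the point \<open>s\<close>.
\<close>

definition M_matrix ::
  "real^'p^'n \<Rightarrow> ('p \<Rightarrow> 'j::finite) \<Rightarrow> ('j \<Rightarrow> real) \<Rightarrow> real \<Rightarrow> 'j set \<Rightarrow> real \<Rightarrow> ('n \<Rightarrow> 'j + 'p) \<Rightarrow>
     real^'p^'p \<Rightarrow> real^'j \<Rightarrow> real^'p \<Rightarrow> real^'n^'p" where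
  "M_matrix X grp w \<rho> A lam e Ts r s =
     (\<chi> i m. case e m of
         Inl j \<Rightarrow> block_mult grp (gram X) j (eta_vec \<rho> s) $ i
       | Inr k \<Rightarrow> ((scaled_gram X grp r ** D_matrix grp \<rho> A s + lam *\<^sub>R weight_matrix grp w) ** Ts) $ i $ k)"

definition jacobian ::
  "real^'p^'n \<Rightarrow> ('p \<Rightarrow> 'j::finite) \<Rightarrow> ('j \<Rightarrow> real) \<Rightarrow> real \<Rightarrow> 'j set \<Rightarrow> real \<Rightarrow> ('n \<Rightarrow> 'j + 'p) \<Rightarrow>
     real^'p^'p \<Rightarrow> real^'j \<Rightarrow> real^'p \<Rightarrow> real" where
  "jacobian X grp w \<rho> A lam e Ts r s =
     det (sqrt (real CARD('n)) *\<^sub>R (pinv (transpose X) ** M_matrix X grp w \<rho> A lam e Ts r s))"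

definition aug_density ::
  "(real^'n \<Rightarrow> real) \<Rightarrow> real^'p^'n \<Rightarrow> ('p \<Rightarrow> 'j::finite) \<Rightarrow> ('j \<Rightarrow> real) \<Rightarrow> real \<Rightarrow> real^'p \<Rightarrow> real \<Rightarrow>
     ('n \<Rightarrow> 'j + 'p) \<Rightarrow> (real^'p \<Rightarrow> real^'p^'p) \<Rightarrow> 'j set \<Rightarrow> real^'j \<Rightarrow> real^'p \<Rightarrow> real" where
  "aug_density g X grp w \<rho> \<beta>\<^sub>0 lam e T A r s =
     g (H_map X grp w \<rho> A \<beta>\<^sub>0 lam r s) * \<bar>jacobian X grp w \<rho> A lam e (T s) r s\<bar>"

end

theory Submission
  imports Defs
begin

text \<open>
  The Karush--Kuhn--Tucker conditions say that \<open>z\<close> is the scaled noise of a model whose augmented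
  estimator is \<open>(r, s, A)\<close> exactly when \<open>z = H_map \<dots> r s\<close>: the bracket in \<open>H_map\<close> lies in the range
  of $X^T$, on which $(X^T)^+$ inverts $X^T$. The map is injective because the estimator is unique. Indeed two
  solutions share the fit and the subgradient \<open>s\<close>; writing \<open>s\<close> as $M^T u$, the vectors
  $M_{(j)} \eta(s_{(j)})$ of the saturated blocks lie on the hyperplane $\langle x, u\rangle = 1$, so general
  position makes them linearly independent. Hence the event is the preimage under the scaled noise of the image of
  \<open>\<Gamma> \<times> \<Delta>\<close> under a differentiable injective map, and its probability is given by the change of
  variables formula.

  Two points need care. For \<open>\<rho> < 1\<close> the function \<open>\<eta>\<close> is not differentiable at \<open>0\<close>; therefore \<open>\<Delta>\<close> is
  cut into the finitely many pieces on which the zero pattern of \<open>s\<close> is constant, and the change of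
  variables formula is used with derivatives within those pieces. The event is measurable because the
  solution is a Borel function of the response.
\<close>

section \<open>Change of variables over arbitrary finite index types\<close>

text \<open>Subdifferentials never appear. Optimality is phrased through Hoelder's inequality for
  the block norms, and its case of equality supplies everything needed about them: the norm
  condition on active blocks, the formula b = r * eta(s) there, and the bijection between solutions
  and coordinates.

  The zero patterns cannot be dismissed as a null set. If \<open>A\<close> has n elements, the chart
  is a single point carrying unit mass, and this point may have zero coordinates. Cutting works
  because the change of variables formula accepts derivatives within an arbitrary measurable set, so
  that the pieces need not be open.

  The coordinates live in two different vector types, one indexed by groups and one by covariates. A
  determinant needs a self-map of \<open>real^'n\<close>; the enumeration \<open>e\<close> glues
  both groups of coordinates into one vector, and the product of their Lebesgue measures becomes
  \<open>lborel\<close>.\<close>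

lemma prod_Basis_cart:
  fixes v :: "real^'n"
  shows "(\<Prod>b\<in>Basis. v \<bullet> b) = (\<Prod>i\<in>UNIV. v $ i)"
proof -
  have "(\<Prod>b\<in>Basis. v \<bullet> b) = (\<Prod>b\<in>range (\<lambda>i. axis i 1). v \<bullet> b)"
    by (rule prod.cong) (auto simp: Basis_vec_def)
  moreover have "inj (\<lambda>i. axis i 1 :: real^'n)"
    by (auto simp: inj_on_def axis_eq_axis)
  ultimately show ?thesis
    by (simp add: prod.reindex cart_eq_inner_axis o_def)
qed

text \<open>Open boxes determine Lebesgue measure. The coordinate form serves twice: for renaming
  coordinates by a bijection of index types, and for gluing the coordinates in \<open>A\<close> to
  those in \<open>F\<close>.\<close>

lemma lborel_cart_eqI:
  fixes M :: "(real^'n) measure"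
  assumes "sets M = sets borel"
    and "\<And>l u :: real^'n. (\<And>i. l $ i \<le> u $ i) \<Longrightarrow>
           emeasure M {x. \<forall>i. l $ i < x $ i \<and> x $ i < u $ i} = ennreal (\<Prod>i\<in>UNIV. u $ i - l $ i)"
  shows "lborel = M"
proof (rule lborel_eqI)
  fix l u :: "real^'n"
  assume le: "\<And>b. b \<in> Basis \<Longrightarrow> l \<bullet> b \<le> u \<bullet> b"
  have "l $ i \<le> u $ i" for i
    using le[of "axis i 1"] by (simp add: inner_axis axis_in_Basis_iff)
  moreover have "box l u = {x. \<forall>i. l $ i < x $ i \<and> x $ i < u $ i}"
    by (auto simp: mem_box_cart)
  ultimately show "emeasure M (box l u) = (\<Prod>b\<in>Basis. (u - l) \<bullet> b)"
    using assms(2)[of l u] by (simp add: prod_Basis_cart)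
qed (fact assms(1))

lemma emeasure_lborel_cart:
  fixes l u :: "real^'n"
  assumes "\<And>i. l $ i \<le> u $ i"
  shows "emeasure lborel {x. \<forall>i. l $ i < x $ i \<and> x $ i < u $ i} = ennreal (\<Prod>i\<in>UNIV. u $ i - l $ i)"
proof -
  have "l \<bullet> b \<le> u \<bullet> b" if "b \<in> Basis" for b
    using that assms by (auto simp: Basis_vec_def inner_axis)
  then have "emeasure lborel (box l u) = ennreal (\<Prod>b\<in>Basis. (u - l) \<bullet> b)"
    by (simp add: emeasure_lborel_box)
  moreover have "box l u = {x. \<forall>i. l $ i < x $ i \<and> x $ i < u $ i}"
    by (auto simp: mem_box_cart)
  ultimately show ?thesis by (simp add: prod_Basis_cart)
qed

section \<open>Renaming coordinates by a bijection of index types\<close>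

definition reindex :: "('m \<Rightarrow> 'n) \<Rightarrow> real^'n \<Rightarrow> real^'m" where
  "reindex f x = (\<chi> i. x $ f i)"

lemma reindex_nth [simp]: "reindex f x $ i = x $ f i"
  by (simp add: reindex_def)

lemma linear_reindex: "linear (reindex f)"
  by (auto intro!: linearI simp: vec_eq_iff)

lemma bounded_linear_reindex: "bounded_linear (reindex (f :: 'm::finite \<Rightarrow> 'n::finite))"
  by (simp add: linear_reindex linear_conv_bounded_linear[symmetric])

lemma measurable_reindex [measurable]:
  "reindex (f :: 'm::finite \<Rightarrow> 'n::finite) \<in> borel_measurable borel"
  by (intro borel_measurable_continuous_onI linear_continuous_on bounded_linear_reindex)

lemma distr_lborel_reindex:
  fixes f :: "'m::finite \<Rightarrow> 'n::finite"
  assumes f: "bij f"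
  shows "distr lborel borel (reindex f) = lborel"
proof (rule lborel_cart_eqI[symmetric])
  fix l u :: "real^'m"
  assume le: "\<And>i. l $ i \<le> u $ i"
  have sur: "f (inv f k) = k" "inv f (f i) = i" for i k
    using f by (simp_all add: bij_is_surj surj_f_inv_f bij_is_inj)
  let ?B = "{x. \<forall>i. l $ i < x $ i \<and> x $ i < u $ i}"
  have B: "?B \<in> sets borel" by measurable
  have "(\<forall>i. l $ i < x $ f i \<and> x $ f i < u $ i) \<longleftrightarrow>
      (\<forall>k. reindex (inv f) l $ k < x $ k \<and> x $ k < reindex (inv f) u $ k)" for x
    by (metis sur reindex_nth)
  then have vim: "reindex f -` ?B \<inter> space lborel =
      {x. \<forall>k. reindex (inv f) l $ k < x $ k \<and> x $ k < reindex (inv f) u $ k}"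
    by auto
  have "emeasure (distr lborel borel (reindex f)) ?B = emeasure lborel (reindex f -` ?B \<inter> space lborel)"
    by (rule emeasure_distr[OF _ B]) simp
  also have "\<dots> = (\<Prod>k\<in>UNIV. u $ inv f k - l $ inv f k)"
    unfolding vim by (subst emeasure_lborel_cart) (simp_all add: le)
  also have "(\<Prod>k\<in>UNIV. u $ inv f k - l $ inv f k) = (\<Prod>i\<in>UNIV. u $ i - l $ i)"
    by (rule prod.reindex_bij_betw) (use f bij_imp_bij_inv in blast)
  finally show "emeasure (distr lborel borel (reindex f)) ?B = ennreal (\<Prod>i\<in>UNIV. u $ i - l $ i)" .
qed simp

text \<open>Conjugation by \<open>f\<close> is a sign-preserving bijection between the permutations
  of the two index types, and it matches the terms of the two Leibniz sums.\<close>

lemma det_reindex: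
  fixes f :: "'m::finite \<Rightarrow> 'n::finite" and A :: "real^'n^'n"
  assumes f: "bij f"
  shows "det (\<chi> i j. A $ f i $ f j) = det A"
proof -
  let ?P = "\<lambda>p. map_permutation UNIV f p"
  have P: "?P p (f i) = f (p i)" for p i
    using f by (simp add: map_permutation_def restrict_id_def bij_is_inj bij_is_surj)
  have bij: "bij_betw ?P {p. p permutes (UNIV :: 'm set)} {p. p permutes (UNIV :: 'n set)}"
  proof (rule bij_betw_byWitness[where f' = "\<lambda>p. map_permutation UNIV (inv f) p"])
    show "\<forall>p\<in>{p. p permutes UNIV}. map_permutation UNIV (inv f) (map_permutation UNIV f p) = p"
      using map_permutation_compose_inv[OF f] inv_f_f[OF bij_is_inj[OF f]] by blast
    show "\<forall>p\<in>{p. p permutes UNIV}. map_permutation UNIV f (map_permutation UNIV (inv f) p) = p"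
      using map_permutation_compose_inv[OF bij_imp_bij_inv[OF f]] surj_f_inv_f[OF bij_is_surj[OF f]] by blast
    show "map_permutation UNIV f ` {p. p permutes UNIV} \<subseteq> {p. p permutes UNIV}"
      using map_permutation_permutes[OF f] by blast
    show "map_permutation UNIV (inv f) ` {p. p permutes UNIV} \<subseteq> {p. p permutes UNIV}"
      using map_permutation_permutes[OF bij_imp_bij_inv[OF f]] by blast
  qed
  have "det (\<chi> i j. A $ f i $ f j) =
      (\<Sum>p | p permutes (UNIV :: 'm set). of_int (sign p) * (\<Prod>i\<in>UNIV. A $ f i $ f (p i)))"
    by (simp add: det_def)
  also have "\<dots> = (\<Sum>p | p permutes (UNIV :: 'm set). of_int (sign (?P p)) * (\<Prod>i\<in>UNIV. A $ i $ ?P p i))"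
  proof (rule sum.cong)
    fix p assume p: "p \<in> {p. p permutes (UNIV :: 'm set)}"
    have "sign (?P p) = sign p"
      using f p by (intro sign_map_permutation) (auto simp: bij_is_inj)
    moreover have "(\<Prod>i\<in>UNIV. A $ f i $ ?P p (f i)) = (\<Prod>i\<in>UNIV. A $ i $ ?P p i)"
      by (rule prod.reindex_bij_betw) (use f in simp)
    ultimately show "of_int (sign p) * (\<Prod>i\<in>UNIV. A $ f i $ f (p i)) =
        of_int (sign (?P p)) * (\<Prod>i\<in>UNIV. A $ i $ ?P p i)"
      by (simp add: P)
  qed simp
  also have "\<dots> = (\<Sum>p | p permutes (UNIV :: 'n set). of_int (sign p) * (\<Prod>i\<in>UNIV. A $ i $ p i))"
    by (rule sum.reindex_bij_betw[OF bij])
  finally show ?thesis by (simp add: det_def)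
qed

text \<open>
  The change of variables formula of the library requires a well-ordered index type. Every finite
  type has the following well-ordered copy.
\<close>

typedef 'a ordered_copy = "UNIV :: 'a set" by simp

instance ordered_copy :: (finite) finite
proof
  show "finite (UNIV :: 'a ordered_copy set)"
    using finite_imageI[OF finite[of "UNIV :: 'a set"], of Abs_ordered_copy]
    unfolding type_definition.Abs_image[OF type_definition_ordered_copy] .
qed

text \<open>Any injection into the naturals will do; the order is pulled back from it, and its
  particular values never matter.\<close>

definition ordered_copy_index :: "'a::finite ordered_copy \<Rightarrow> nat" where
  "ordered_copy_index = (SOME f. inj f)"

lemma inj_ordered_copy_index: "inj (ordered_copy_index :: 'a::finite ordered_copy \<Rightarrow> nat)"
proof -
  have "\<exists>f :: 'a ordered_copy \<Rightarrow> nat. inj f"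
    using finite_imp_inj_to_nat_seg[OF finite] by blast
  then show ?thesis unfolding ordered_copy_index_def by (rule someI_ex)
qed

instantiation ordered_copy :: (finite) wellorder
begin

definition less_eq_ordered_copy :: "'a ordered_copy \<Rightarrow> 'a ordered_copy \<Rightarrow> bool" where
  "x \<le> y \<longleftrightarrow> ordered_copy_index x \<le> ordered_copy_index y"

definition less_ordered_copy :: "'a ordered_copy \<Rightarrow> 'a ordered_copy \<Rightarrow> bool" where
  "x < y \<longleftrightarrow> ordered_copy_index x < ordered_copy_index y"

instance
proof
  fix P :: "'a ordered_copy \<Rightarrow> bool" and a :: "'a ordered_copy"
  assume step: "\<And>x. (\<And>y. y < x \<Longrightarrow> P y) \<Longrightarrow> P x"
  show "P a"
  proof (induction a rule: measure_induct_rule[of ordered_copy_index])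
    case (less x)
    then show ?case by (rule step) (simp add: less_ordered_copy_def)
  qed
next
  fix x y :: "'a ordered_copy"
  assume "x \<le> y" "y \<le> x"
  then show "x = y"
    by - (rule injD[OF inj_ordered_copy_index], simp add: less_eq_ordered_copy_def)
qed (auto simp: less_eq_ordered_copy_def less_ordered_copy_def)

end

lemma bij_Rep_ordered_copy: "bij Rep_ordered_copy"
proof (rule bijI)
  show "inj Rep_ordered_copy" by (simp add: inj_def Rep_ordered_copy_inject)
  show "surj Rep_ordered_copy" by (rule surjI[of _ Abs_ordered_copy]) (simp add: Abs_ordered_copy_inverse)
qed

text \<open>The underlying formula speaks of absolutely integrable functions and gauge integrals.
  Since \<open>g\<close> is nonnegative, these values agree with the extended nonnegative
  integrals.\<close>

lemma nn_integral_change_of_variables_wellorder: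
  fixes h :: "real^'m::{finite,wellorder} \<Rightarrow> real^'m::_" and g :: "real^'m::_ \<Rightarrow> real"
  assumes S: "S \<in> sets borel" "h ` S \<in> sets borel"
    and der: "\<And>x. x \<in> S \<Longrightarrow> (h has_derivative h' x) (at x within S)"
    and inj: "inj_on h S"
    and g: "\<And>x. 0 \<le> g x" "integrable lborel g"
  shows "(\<integral>\<^sup>+x\<in>h ` S. ennreal (g x) \<partial>lborel) =
    (\<integral>\<^sup>+x\<in>S. ennreal (g (h x) * \<bar>det (matrix (h' x))\<bar>) \<partial>lborel)"
proof -
  have "set_integrable lborel (h ` S) g"
    unfolding set_integrable_def using S g(2) by (intro integrable_mult_indicator) auto
  then have "g absolutely_integrable_on h ` S"
    unfolding set_integrable_def by (intro integrable_completion[THEN iffD2]) auto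
  \<comment> \<open>The underlying formula is for vector-valued integrands, hence the detour through
    \<open>real^1\<close>.\<close>
  then have *: "(\<lambda>x. vec (g x) :: real^1) absolutely_integrable_on h ` S"
    by (simp add: absolutely_integrable_on_1_iff)
  have SL: "S \<in> sets lebesgue" using S by simp
  note cov = has_absolute_integral_change_of_variables[OF SL der inj, of "\<lambda>x. vec (g x) :: real^1"]
  from * cov
  have "(\<lambda>x. \<bar>det (matrix (h' x))\<bar> *\<^sub>R (vec (g (h x)) :: real^1)) absolutely_integrable_on S"
    and "integral S (\<lambda>x. \<bar>det (matrix (h' x))\<bar> *\<^sub>R (vec (g (h x)) :: real^1)) = integral (h ` S) (\<lambda>x. vec (g x))"
    by blast+
  then have 1: "(\<lambda>x. g (h x) * \<bar>det (matrix (h' x))\<bar>) absolutely_integrable_on S"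
    and 2: "integral S (\<lambda>x. g (h x) * \<bar>det (matrix (h' x))\<bar>) = integral (h ` S) g"
    by (simp_all add: absolutely_integrable_on_1_iff integral_on_1_eq mult.commute)
  have "((\<lambda>x. g (h x) * \<bar>det (matrix (h' x))\<bar>) has_integral integral (h ` S) g) S"
    using 1 2 by (simp add: has_integral_iff set_lebesgue_integral_eq_integral(1))
  moreover have "(g has_integral integral (h ` S) g) (h ` S)"
    using \<open>g absolutely_integrable_on h ` S\<close>
    by (simp add: has_integral_iff set_lebesgue_integral_eq_integral(1))
  ultimately show ?thesis
    using g(1) by (simp add: nn_integral_has_integral_lebesgue')
qed

text \<open>Conjugation with a renaming of coordinates, which preserves both Lebesgue measure and
  the determinant. The hypothesis \<open>meas\<close> lets the right-hand integral be transported
  back along \<open>distr\<close>, which requires a Borel integrand; nothing else controls how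
  \<open>h'\<close> depends on the point.\<close>

lemma nn_integral_change_of_variables:
  fixes h :: "real^'n \<Rightarrow> real^'n" and g :: "real^'n \<Rightarrow> real"
  assumes S: "S \<in> sets borel" "h ` S \<in> sets borel"
    and der: "\<And>x. x \<in> S \<Longrightarrow> (h has_derivative h' x) (at x within S)"
    and inj: "inj_on h S"
    and g: "\<And>x. 0 \<le> g x" "integrable lborel g"
    and meas: "(\<lambda>x. ennreal (g (h x) * \<bar>det (matrix (h' x))\<bar>) * indicator S x) \<in> borel_measurable borel"
  shows "(\<integral>\<^sup>+x\<in>h ` S. ennreal (g x) \<partial>lborel) =
    (\<integral>\<^sup>+x\<in>S. ennreal (g (h x) * \<bar>det (matrix (h' x))\<bar>) \<partial>lborel)"
proof -
  let ?f = "Rep_ordered_copy :: 'n ordered_copy \<Rightarrow> 'n"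
  let ?Q = "reindex ?f" and ?R = "reindex (inv ?f)"
  have f: "bij ?f" "bij (inv ?f)"
    using bij_Rep_ordered_copy bij_imp_bij_inv by blast+
  have fi [simp]: "?f (inv ?f k) = k" "inv ?f (?f i) = i" for i k
    using f by (simp_all add: bij_is_surj surj_f_inv_f bij_is_inj)
  have QR [simp]: "?Q (?R x) = x" "?R (?Q y) = y" for x y
    by (simp_all add: vec_eq_iff)
  have dR: "lborel = distr lborel borel ?R"
    using distr_lborel_reindex[OF f(2)] by simp
  define k where "k = ?Q \<circ> h \<circ> ?R"
  define k' where "k' x = ?Q \<circ> h' (?R x) \<circ> ?R" for x
  have image: "?Q ` Z = ?R -` Z \<inter> space borel" for Z
  proof
    show "?R -` Z \<inter> space borel \<subseteq> ?Q ` Z"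
      by (metis IntE QR(1) image_eqI subsetI vimageE)
  qed auto
  have sets: "?Q ` Z \<in> sets borel" if "Z \<in> sets borel" for Z
    unfolding image by (rule measurable_sets[OF measurable_reindex that])
  have kimage: "k ` ?Q ` S = ?Q ` h ` S"
    by (simp add: k_def image_image)
  have ind: "indicator (?Q ` Z) (?Q x) = (indicator Z x :: ennreal)" for Z x
  proof -
    have "?Q x \<in> ?Q ` Z \<longleftrightarrow> x \<in> Z" by (auto simp: image_iff) (metis QR(2))
    then show ?thesis by (simp add: indicator_def)
  qed
  have der_k: "(k has_derivative k' x) (at x within ?Q ` S)" if x: "x \<in> ?Q ` S" for x
  proof -
    have "(?R has_derivative ?R) (at x within ?Q ` S)"
      by (rule bounded_linear_imp_has_derivative[OF bounded_linear_reindex])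
    moreover have "(h has_derivative h' (?R x)) (at (?R x) within ?R ` ?Q ` S)"
      using x der by (auto simp: image_image)
    ultimately have "((h \<circ> ?R) has_derivative (h' (?R x) \<circ> ?R)) (at x within ?Q ` S)"
      by (rule diff_chain_within)
    from bounded_linear.has_derivative[OF bounded_linear_reindex this]
    show ?thesis by (simp add: k_def k'_def o_def)
  qed
  \<comment> \<open>Renaming sends basis vectors to basis vectors, so the matrix of the conjugate is
    the old one with rows and columns renamed by the same bijection.\<close>
  have det: "det (matrix (k' (?Q x))) = det (matrix (h' x))" if "x \<in> S" for x
  proof -
    have "inv ?f k = i \<longleftrightarrow> k = ?f i" for i k
      using bij_inv_eq_iff[OF f(1)] by metis
    then have "?R (axis i 1) = axis (?f i) 1" for i
      by (simp add: vec_eq_iff axis_def)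
    then have "matrix (k' (?Q x)) = (\<chi> i j. matrix (h' x) $ ?f i $ ?f j)"
      by (simp add: matrix_def k'_def QR)
    then show ?thesis using det_reindex[OF f(1)] by simp
  qed
  have inj_k: "inj_on k (?Q ` S)"
  proof (rule inj_onI)
    fix x y assume "x \<in> ?Q ` S" "y \<in> ?Q ` S" "k x = k y"
    then obtain a b where ab: "a \<in> S" "b \<in> S" "x = ?Q a" "y = ?Q b" "?Q (h a) = ?Q (h b)"
      by (auto simp: k_def)
    then have "h a = h b" by (metis QR(2))
    then show "x = y" using inj ab by (metis inj_onD)
  qed
  have gm [measurable]: "g \<in> borel_measurable borel"
    using g(2) by auto
  have "integrable (distr lborel borel ?R) g"
    using g(2) dR by simp
  then have gR: "integrable lborel (g \<circ> ?R)"
    by (simp add: integrable_distr_eq o_def)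
  note S [measurable]
  have pull: "(\<integral>\<^sup>+x. F x \<partial>(lborel :: (real^'n) measure)) = (\<integral>\<^sup>+x. F (?R x) \<partial>lborel)"
    if "F \<in> borel_measurable borel" for F
    using that by (subst dR) (rule nn_integral_distr, simp_all)
  have "(\<integral>\<^sup>+x\<in>h ` S. ennreal (g x) \<partial>lborel) = (\<integral>\<^sup>+x. ennreal (g (?R x)) * indicator (h ` S) (?R x) \<partial>lborel)"
    by (rule pull) measurable
  also have "\<dots> = (\<integral>\<^sup>+x\<in>k ` ?Q ` S. ennreal ((g \<circ> ?R) x) \<partial>lborel)"
  proof (intro nn_integral_cong)
    fix x
    show "ennreal (g (?R x)) * indicator (h ` S) (?R x) =
      ennreal ((g \<circ> ?R) x) * indicator (k ` ?Q ` S) x"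
      unfolding kimage using ind[of "h ` S" "?R x"] by simp
  qed
  also have "\<dots> = (\<integral>\<^sup>+x\<in>?Q ` S. ennreal ((g \<circ> ?R) (k x) * \<bar>det (matrix (k' x))\<bar>) \<partial>lborel)"
  proof (rule nn_integral_change_of_variables_wellorder[OF _ _ der_k inj_k _ gR])
    show "?Q ` S \<in> sets borel" "k ` ?Q ` S \<in> sets borel"
      unfolding kimage by (rule sets S)+
  qed (simp_all add: g(1))
  also have "\<dots> = (\<integral>\<^sup>+x. ennreal (g (h (?R x)) * \<bar>det (matrix (h' (?R x)))\<bar>) * indicator S (?R x) \<partial>lborel)"
  proof (intro nn_integral_cong)
    fix x
    obtain z where z: "x = ?Q z" by (metis QR(1))
    show "ennreal ((g \<circ> ?R) (k x) * \<bar>det (matrix (k' x))\<bar>) * indicator (?Q ` S) x =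
      ennreal (g (h (?R x)) * \<bar>det (matrix (h' (?R x)))\<bar>) * indicator S (?R x)"
      using det[of z] by (cases "z \<in> S") (simp_all add: z ind k_def)
  qed
  also have "\<dots> = (\<integral>\<^sup>+x\<in>S. ennreal (g (h x) * \<bar>det (matrix (h' x))\<bar>) \<partial>lborel)"
    by (rule pull[symmetric]) (rule meas)
  finally show ?thesis .
qed

section \<open>Duality of the block norms\<close>

text \<open>Stated for families over an arbitrary index set, so that duality is proved once for a
  single block.\<close>

definition pnorm :: "real \<Rightarrow> 'k set \<Rightarrow> ('k \<Rightarrow> real) \<Rightarrow> real" where
  "pnorm a K v = (\<Sum>k\<in>K. \<bar>v k\<bar> powr a) powr (1 / a)"

lemma block_norm_eq_pnorm: "block_norm grp a j v = pnorm a (block grp j) (($) v)"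
  by (simp add: block_norm_def pnorm_def)

lemma pnorm_nonneg [simp]: "0 \<le> pnorm a K v"
  by (simp add: pnorm_def)

lemma pnorm_cong: "(\<And>k. k \<in> K \<Longrightarrow> u k = v k) \<Longrightarrow> pnorm a K u = pnorm a K v"
  by (simp add: pnorm_def cong: sum.cong)

lemma pnorm_powr:
  assumes "0 < a"
  shows "pnorm a K v powr a = (\<Sum>k\<in>K. \<bar>v k\<bar> powr a)"
  using assms by (simp add: pnorm_def powr_powr sum_nonneg)

lemma pnorm_zero [simp]: "0 < a \<Longrightarrow> pnorm a K (\<lambda>k. 0) = 0"
  by (simp add: pnorm_def)

lemma pnorm_scale:
  assumes "0 < a"
  shows "pnorm a K (\<lambda>k. c * v k) = \<bar>c\<bar> * pnorm a K v"
proof -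
  have "(\<Sum>k\<in>K. \<bar>c * v k\<bar> powr a) = \<bar>c\<bar> powr a * (\<Sum>k\<in>K. \<bar>v k\<bar> powr a)"
    by (simp add: abs_mult powr_mult sum_distrib_left)
  then show ?thesis
    using assms by (simp add: pnorm_def powr_mult sum_nonneg powr_powr)
qed

lemma abs_le_pnorm:
  assumes "0 < a" "finite K" "k \<in> K"
  shows "\<bar>v k\<bar> \<le> pnorm a K v"
proof -
  have "\<bar>v k\<bar> powr a \<le> (\<Sum>k\<in>K. \<bar>v k\<bar> powr a)"
    using assms by (intro member_le_sum) auto
  then have "(\<bar>v k\<bar> powr a) powr (1 / a) \<le> pnorm a K v"
    unfolding pnorm_def using assms by (intro powr_mono2) auto
  then show ?thesis using assms by (simp add: powr_powr)
qed

lemma pnorm_eq_0_iff: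
  assumes "0 < a" "finite K"
  shows "pnorm a K v = 0 \<longleftrightarrow> (\<forall>k\<in>K. v k = 0)"
proof
  assume "pnorm a K v = 0"
  then show "\<forall>k\<in>K. v k = 0" using abs_le_pnorm[OF assms, of _ v] by fastforce
next
  assume "\<forall>k\<in>K. v k = 0"
  then show "pnorm a K v = 0" using pnorm_cong[of K v "\<lambda>k. 0" a] assms by simp
qed

lemma pnorm_eq_1_iff:
  assumes "0 < a"
  shows "pnorm a K v = 1 \<longleftrightarrow> (\<Sum>k\<in>K. \<bar>v k\<bar> powr a) = 1"
proof
  assume "pnorm a K v = 1"
  then show "(\<Sum>k\<in>K. \<bar>v k\<bar> powr a) = 1" using pnorm_powr[OF assms, of K v] by simp
qed (simp add: pnorm_def)

lemma pnorm_le_1_iff: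
  assumes "0 < a"
  shows "pnorm a K v \<le> 1 \<longleftrightarrow> (\<Sum>k\<in>K. \<bar>v k\<bar> powr a) \<le> 1"
proof
  assume "pnorm a K v \<le> 1"
  then have "pnorm a K v powr a \<le> 1 powr a" using assms by (intro powr_mono2) auto
  then show "(\<Sum>k\<in>K. \<bar>v k\<bar> powr a) \<le> 1" using assms by (simp add: pnorm_powr)
next
  assume "(\<Sum>k\<in>K. \<bar>v k\<bar> powr a) \<le> 1"
  then have "(\<Sum>k\<in>K. \<bar>v k\<bar> powr a) powr (1 / a) \<le> 1 powr (1 / a)"
    using assms by (intro powr_mono2) (auto intro: sum_nonneg)
  then show "pnorm a K v \<le> 1" by (simp add: pnorm_def)
qed

lemma eta_0 [simp]: "eta \<rho> 0 = 0"
  by (simp add: eta_def)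

lemma abs_eta: "\<bar>eta \<rho> x\<bar> = \<bar>x\<bar> powr \<rho>"
  by (cases "x = 0") (simp_all add: eta_def abs_mult abs_sgn_eq)

locale conjugate_exponents =
  fixes \<alpha> \<alpha>s \<rho> :: real
  assumes \<alpha>_gt_1: "1 < \<alpha>" and conj: "1 / \<alpha> + 1 / \<alpha>s = 1" and \<rho>_eq: "\<rho> = \<alpha>s / \<alpha>"
begin

lemma \<alpha>s_gt_1: "1 < \<alpha>s"
proof -
  have "0 < 1 / \<alpha>" "1 / \<alpha> < 1" using \<alpha>_gt_1 by simp_all
  then have "0 < 1 / \<alpha>s" "1 / \<alpha>s < 1" using conj by linarith+
  then show ?thesis by (simp add: field_simps split: if_splits)
qed

lemma exponents_pos: "0 < \<alpha>" "0 < \<alpha>s" "0 < \<rho>"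
  using \<alpha>_gt_1 \<alpha>s_gt_1 by (auto simp: \<rho>_eq)

lemma \<rho>_mult_\<alpha>: "\<rho> * \<alpha> = \<alpha>s"
  using exponents_pos by (simp add: \<rho>_eq)

lemma \<rho>_plus_1: "\<rho> + 1 = \<alpha>s"
proof -
  have "\<alpha>s * (1 / \<alpha> + 1 / \<alpha>s) = \<alpha>s" using conj by simp
  then show ?thesis using exponents_pos by (simp add: \<rho>_eq algebra_simps)
qed

lemma mult_eta: "x * eta \<rho> x = \<bar>x\<bar> powr \<alpha>s"
proof (cases "x = 0")
  case False
  have "x * eta \<rho> x = (x * sgn x) * \<bar>x\<bar> powr \<rho>" by (simp add: eta_def)
  also have "x * sgn x = \<bar>x\<bar> powr 1" using False by (simp add: sgn_if)
  finally show ?thesis unfolding powr_add[symmetric] \<rho>_plus_1[symmetric] by (simp add: add.commute)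
qed simp

lemma young: "t * x \<le> \<bar>t\<bar> powr \<alpha> / \<alpha> + \<bar>x\<bar> powr \<alpha>s / \<alpha>s"
proof -
  have "t * x \<le> \<bar>t\<bar> * \<bar>x\<bar>" by (metis abs_ge_self abs_mult)
  also have "\<dots> \<le> \<bar>t\<bar> powr \<alpha> / \<alpha> + \<bar>x\<bar> powr \<alpha>s / \<alpha>s"
    using \<alpha>_gt_1 \<alpha>s_gt_1 conj by (intro Youngs_inequality) auto
  finally show ?thesis .
qed

text \<open>With c = |t|^\<alpha>, d = |x|^\<alpha>s and m = c/\<alpha> + d/\<alpha>s, the
  assumption says that ln m is the weighted mean of ln c and ln d. Averaging the tangent bound ln z
  \<le> z - 1 over z = c/m and z = d/m gives 0 on both sides, so both bounds are equalities and c =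
  m = d.\<close>

lemma young_eq:
  assumes eq: "t * x = \<bar>t\<bar> powr \<alpha> / \<alpha> + \<bar>x\<bar> powr \<alpha>s / \<alpha>s"
  shows "t = eta \<rho> x"
proof (cases "t = 0 \<or> x = 0")
  case True
  then have "\<bar>t\<bar> powr \<alpha> / \<alpha> + \<bar>x\<bar> powr \<alpha>s / \<alpha>s = 0" using eq by auto
  moreover have "0 \<le> \<bar>t\<bar> powr \<alpha> / \<alpha>" "0 \<le> \<bar>x\<bar> powr \<alpha>s / \<alpha>s" using exponents_pos by simp_all
  ultimately have "\<bar>t\<bar> powr \<alpha> / \<alpha> = 0" "\<bar>x\<bar> powr \<alpha>s / \<alpha>s = 0" by linarith+
  then show ?thesis using exponents_pos by simp
next
  case False
  define c d m where "c = \<bar>t\<bar> powr \<alpha>" and "d = \<bar>x\<bar> powr \<alpha>s" and "m = c / \<alpha> + d / \<alpha>s"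
  have pos: "0 < c" "0 < d" "0 < m"
    using False exponents_pos by (auto simp: c_def d_def m_def intro!: add_pos_pos)
  have "\<bar>t\<bar> * \<bar>x\<bar> \<le> m"
    unfolding m_def c_def d_def
    using \<alpha>_gt_1 \<alpha>s_gt_1 conj by (intro Youngs_inequality) auto
  moreover have "t * x = m" using eq by (simp add: m_def c_def d_def)
  moreover have "t * x \<le> \<bar>t\<bar> * \<bar>x\<bar>" by (metis abs_ge_self abs_mult)
  ultimately have tx: "t * x = \<bar>t\<bar> * \<bar>x\<bar>" and m: "m = \<bar>t\<bar> * \<bar>x\<bar>" by linarith+
  have "ln m = ln \<bar>t\<bar> + ln \<bar>x\<bar>" using False by (simp add: m ln_mult)
  also have "ln \<bar>t\<bar> = ln c / \<alpha>" using False exponents_pos by (simp add: c_def ln_powr)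
  also have "ln \<bar>x\<bar> = ln d / \<alpha>s" using False exponents_pos by (simp add: d_def ln_powr)
  finally have lnm: "ln m = ln c / \<alpha> + ln d / \<alpha>s" .
  have "(ln c - ln m) / \<alpha> + (ln d - ln m) / \<alpha>s = ln c / \<alpha> + ln d / \<alpha>s - ln m * (1 / \<alpha> + 1 / \<alpha>s)"
    by (simp add: algebra_simps diff_divide_distrib)
  also have "\<dots> = 0" by (simp only: conj lnm[symmetric])
  finally have "ln (c / m) / \<alpha> + ln (d / m) / \<alpha>s = 0"
    using pos by (simp add: ln_div conj)
  moreover have "(c / m - 1) / \<alpha> + (d / m - 1) / \<alpha>s = (c / \<alpha> + d / \<alpha>s) / m - (1 / \<alpha> + 1 / \<alpha>s)"
    by (simp add: diff_divide_distrib add_divide_distrib mult.commute)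
  then have "(c / m - 1) / \<alpha> + (d / m - 1) / \<alpha>s = 0"
    using pos by (simp add: m_def[symmetric] conj)
  moreover have "ln (c / m) \<le> c / m - 1" "ln (d / m) \<le> d / m - 1"
    using pos by (auto intro!: ln_le_minus_one)
  then have "ln (c / m) / \<alpha> \<le> (c / m - 1) / \<alpha>" "ln (d / m) / \<alpha>s \<le> (d / m - 1) / \<alpha>s"
    using exponents_pos by (auto intro!: divide_right_mono)
  ultimately have "ln (c / m) / \<alpha> = (c / m - 1) / \<alpha>" "ln (d / m) / \<alpha>s = (d / m - 1) / \<alpha>s"
    by linarith+
  then have "ln (c / m) = c / m - 1" "ln (d / m) = d / m - 1"
    using exponents_pos by simp_all
  then have "c / m = 1" "d / m = 1" using pos ln_eq_minus_one[of "c / m"] ln_eq_minus_one[of "d / m"] by simp_all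
  then have "\<bar>t\<bar> powr \<alpha> = \<bar>x\<bar> powr \<alpha>s" using pos by (simp add: c_def d_def)
  then have "(\<bar>t\<bar> powr \<alpha>) powr (1 / \<alpha>) = (\<bar>x\<bar> powr \<alpha>s) powr (1 / \<alpha>)" by simp
  then have "\<bar>t\<bar> = \<bar>x\<bar> powr \<rho>" using exponents_pos by (simp add: powr_powr \<rho>_eq)
  \<comment> \<open>The powers only see absolute values; the sign is recovered from t * x = |t| *
    |x|.\<close>
  moreover have "sgn t = sgn x"
    using tx False by (auto simp: sgn_if abs_if mult_less_0_iff split: if_splits)
  ultimately show ?thesis by (simp add: eta_def) (metis sgn_mult_abs)
qed

lemma pnorm_eta: "pnorm \<alpha> K (\<lambda>k. eta \<rho> (s k)) = (\<Sum>k\<in>K. \<bar>s k\<bar> powr \<alpha>s) powr (1 / \<alpha>)"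
  by (simp add: pnorm_def abs_eta powr_powr \<rho>_mult_\<alpha>)

lemma sum_mult_eta: "(\<Sum>k\<in>K. s k * eta \<rho> (s k)) = (\<Sum>k\<in>K. \<bar>s k\<bar> powr \<alpha>s)"
  by (simp add: mult_eta)

text \<open>Normalize \<open>b\<close> and sum Young's inequality over \<open>K\<close>: the
  right-hand sides add up to at most 1/\<alpha> + 1/\<alpha>s = 1. If the total is attained, each
  single inequality is an equality, and \<open>young_eq\<close> determines \<open>b\<close> from
  \<open>s\<close> and its norm. This second part is the description of subgradients at a nonzero
  point.\<close>

lemma hoelder:
  assumes "finite K" and s: "pnorm \<alpha>s K s \<le> 1"
  shows "(\<Sum>k\<in>K. s k * b k) \<le> pnorm \<alpha> K b"
    and "(\<Sum>k\<in>K. s k * b k) = pnorm \<alpha> K b \<Longrightarrow> pnorm \<alpha> K b \<noteq> 0 \<Longrightarrow>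
      pnorm \<alpha>s K s = 1 \<and> (\<forall>k\<in>K. b k = pnorm \<alpha> K b * eta \<rho> (s k))"
proof -
  define N where "N = pnorm \<alpha> K b"
  have bound: "(\<Sum>k\<in>K. \<bar>s k\<bar> powr \<alpha>s) \<le> 1" using s exponents_pos pnorm_le_1_iff by metis
  have "(\<Sum>k\<in>K. s k * b k) \<le> N \<and> ((\<Sum>k\<in>K. s k * b k) = N \<longrightarrow> N \<noteq> 0 \<longrightarrow>
      pnorm \<alpha>s K s = 1 \<and> (\<forall>k\<in>K. b k = N * eta \<rho> (s k)))"
  proof (cases "N = 0")
    case True
    then have "\<forall>k\<in>K. b k = 0" using pnorm_eq_0_iff exponents_pos assms(1) N_def by metis
    then show ?thesis using True by simp
  next
    case False
    then have N: "0 < N" using pnorm_nonneg[of \<alpha> K b] unfolding N_def by linarith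
    define t where "t k = b k / N" for k
    have b: "b k = N * t k" for k using N by (simp add: t_def)
    have "N = pnorm \<alpha> K (\<lambda>k. N * t k)" unfolding b[symmetric] by (simp add: N_def)
    then have "N = \<bar>N\<bar> * pnorm \<alpha> K t"
      unfolding pnorm_scale[OF exponents_pos(1)] .
    then have "pnorm \<alpha> K t = 1" using N by simp
    then have t1: "(\<Sum>k\<in>K. \<bar>t k\<bar> powr \<alpha>) = 1" using pnorm_eq_1_iff exponents_pos by metis
    let ?u = "\<lambda>k. \<bar>t k\<bar> powr \<alpha> / \<alpha> + \<bar>s k\<bar> powr \<alpha>s / \<alpha>s"
    have u: "sum ?u K = 1 / \<alpha> + (\<Sum>k\<in>K. \<bar>s k\<bar> powr \<alpha>s) / \<alpha>s"
      by (simp add: sum.distrib sum_divide_distrib[symmetric] t1)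
    have s2: "(\<Sum>k\<in>K. \<bar>s k\<bar> powr \<alpha>s) / \<alpha>s \<le> 1 / \<alpha>s"
      using bound exponents_pos by (intro divide_right_mono) auto
    have u1: "sum ?u K \<le> 1" using u s2 conj by linarith
    have st: "(\<Sum>k\<in>K. t k * s k) \<le> sum ?u K" by (intro sum_mono young)
    have sb: "(\<Sum>k\<in>K. s k * b k) = N * (\<Sum>k\<in>K. t k * s k)"
      by (simp add: b sum_distrib_left mult_ac)
    have "(\<Sum>k\<in>K. s k * b k) \<le> N * 1"
      unfolding sb using N st u1 by (intro mult_left_mono) auto
    moreover have "pnorm \<alpha>s K s = 1 \<and> (\<forall>k\<in>K. b k = N * eta \<rho> (s k))" if "(\<Sum>k\<in>K. s k * b k) = N"
    proof
      have "(\<Sum>k\<in>K. t k * s k) = 1" using that sb N by simp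
      then have e: "(\<Sum>k\<in>K. t k * s k) = sum ?u K" "sum ?u K = 1" using st u1 by linarith+
      then have "(\<Sum>k\<in>K. \<bar>s k\<bar> powr \<alpha>s) / \<alpha>s = 1 / \<alpha>s" using u conj by linarith
      then have "(\<Sum>k\<in>K. \<bar>s k\<bar> powr \<alpha>s) = 1" using exponents_pos by simp
      then show "pnorm \<alpha>s K s = 1" using pnorm_eq_1_iff exponents_pos by metis
      have "(\<Sum>k\<in>K. ?u k - t k * s k) = 0" using e by (simp add: sum_subtractf)
      then have "\<forall>k\<in>K. ?u k - t k * s k = 0"
        using assms(1) young by (subst (asm) sum_nonneg_eq_0_iff) auto
      then have "\<forall>k\<in>K. t k = eta \<rho> (s k)" by (auto intro!: young_eq)
      then show "\<forall>k\<in>K. b k = N * eta \<rho> (s k)" by (simp add: b)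
    qed
    ultimately show ?thesis by auto
  qed
  then show "(\<Sum>k\<in>K. s k * b k) \<le> pnorm \<alpha> K b"
    and "(\<Sum>k\<in>K. s k * b k) = pnorm \<alpha> K b \<Longrightarrow> pnorm \<alpha> K b \<noteq> 0 \<Longrightarrow>
      pnorm \<alpha>s K s = 1 \<and> (\<forall>k\<in>K. b k = pnorm \<alpha> K b * eta \<rho> (s k))"
    by (auto simp: N_def)
qed

lemma dual_norm_attained:
  assumes "finite K"
  obtains s where "pnorm \<alpha>s K s \<le> 1" "(\<Sum>k\<in>K. s k * b k) = pnorm \<alpha> K b"
proof (cases "pnorm \<alpha> K b = 0")
  case True
  show ?thesis
    by (rule that[of "\<lambda>k. 0"]) (use True exponents_pos in auto)
next
  case False
  define N where "N = pnorm \<alpha> K b"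
  then have N: "0 < N" using False pnorm_nonneg[of \<alpha> K b] by linarith
  \<comment> \<open>The inverse of \<open>eta\<close> applied to the normalized \<open>b\<close>,
    that is, the case of equality in Hoelder's inequality.\<close>
  define s where "s k = sgn (b k) * \<bar>b k / N\<bar> powr (1 / \<rho>)" for k
  have abs_s: "\<bar>s k\<bar> = \<bar>b k / N\<bar> powr (1 / \<rho>)" for k
    by (cases "b k = 0") (simp_all add: s_def abs_mult abs_sgn_eq)
  have eta_s: "eta \<rho> (s k) = b k / N" for k
  proof -
    have "sgn (s k) = sgn (b k)" using N by (simp add: s_def sgn_mult sgn_if)
    then show ?thesis
      using exponents_pos N by (simp add: eta_def abs_s powr_powr abs_mult[symmetric])
        (metis abs_divide abs_of_pos mult_sgn_abs times_divide_eq_right)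
  qed
  have "1 / \<rho> * \<alpha>s = \<alpha>" using exponents_pos by (simp add: \<rho>_eq)
  then have "\<bar>s k\<bar> powr \<alpha>s = \<bar>b k\<bar> powr \<alpha> / N powr \<alpha>" for k
    using N by (simp add: abs_s powr_powr powr_divide)
  then have "(\<Sum>k\<in>K. \<bar>s k\<bar> powr \<alpha>s) = (\<Sum>k\<in>K. \<bar>b k\<bar> powr \<alpha>) / N powr \<alpha>"
    by (simp add: sum_divide_distrib)
  also have "\<dots> = 1"
    using N exponents_pos by (simp add: N_def pnorm_powr[symmetric])
  finally have 1: "(\<Sum>k\<in>K. \<bar>s k\<bar> powr \<alpha>s) = 1" .
  have "(\<Sum>k\<in>K. s k * b k) = (\<Sum>k\<in>K. N * (s k * eta \<rho> (s k)))"
    using N by (simp add: eta_s)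
  also have "\<dots> = N" by (simp add: sum_distrib_left[symmetric] sum_mult_eta 1)
  finally show ?thesis
    using that[of s] 1 exponents_pos pnorm_le_1_iff[of \<alpha>s K s] by (simp add: N_def)
qed

text \<open>By duality the norm is a maximum of linear functionals, hence subadditive.\<close>

lemma pnorm_triangle:
  assumes "finite K"
  shows "pnorm \<alpha> K (\<lambda>k. a k + b k) \<le> pnorm \<alpha> K a + pnorm \<alpha> K b"
proof -
  obtain s where s: "pnorm \<alpha>s K s \<le> 1" "(\<Sum>k\<in>K. s k * (a k + b k)) = pnorm \<alpha> K (\<lambda>k. a k + b k)"
    using dual_norm_attained[OF assms, of "\<lambda>k. a k + b k"] by auto
  have "pnorm \<alpha> K (\<lambda>k. a k + b k) = (\<Sum>k\<in>K. s k * a k) + (\<Sum>k\<in>K. s k * b k)"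
    using s(2) by (simp add: algebra_simps sum.distrib)
  also have "\<dots> \<le> pnorm \<alpha> K a + pnorm \<alpha> K b"
    using hoelder(1)[OF assms s(1)] by (intro add_mono)
  finally show ?thesis .
qed

end

section \<open>Optimality conditions\<close>

text \<open>If the vectors span an affine subspace of dimension d, the hyperplane forces d \<le> n -
  1, so general position applies and bounds the number of indices by d + 1. Thus the vectors are
  pairwise distinct and affinely independent. Pairing a vanishing combination with \<open>u\<close>
  shows that its coefficients sum to 0, so a nontrivial one would be an affine dependence.\<close>

lemma general_position_hyperplane_independent:
  fixes v :: "'j::finite \<Rightarrow> real^'n"
  assumes gp: "general_position E v"
    and hyp: "\<And>j. j \<in> E \<Longrightarrow> v j \<bullet> u = 1"
    and zero: "(\<Sum>j\<in>E. c j *\<^sub>R v j) = 0"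
    and i: "i \<in> E"
  shows "c i = 0"
proof (rule ccontr)
  assume ci: "c i \<noteq> 0"
  let ?V = "v ` E"
  have "u \<noteq> 0" using hyp[OF i] by auto
  have "?V \<subseteq> {x. u \<bullet> x = 1}" using hyp by (auto simp: inner_commute)
  then have "aff_dim ?V \<le> aff_dim {x. u \<bullet> x = 1}" by (rule aff_dim_subset)
  also have "\<dots> = int CARD('n) - 1" using \<open>u \<noteq> 0\<close> by simp
  finally have d_le: "aff_dim ?V \<le> int CARD('n) - 1" .
  have d_ge: "0 \<le> aff_dim ?V" using i aff_dim_negative_iff[of ?V] by (auto simp: not_less[symmetric])
  obtain d where d: "aff_dim ?V = int d" using d_ge nonneg_int_cases by metis
  have "card {j\<in>E. v j \<in> affine hull ?V} \<le> d + 1"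
    using gp d d_le unfolding general_position_def by (simp add: aff_dim_affine_hull)
  moreover have "{j\<in>E. v j \<in> affine hull ?V} = E" by (auto intro: hull_inc)
  ultimately have "card E \<le> d + 1" by simp
  moreover have "int d \<le> int (card ?V) - 1"
    using aff_dim_le_card[of ?V] d by simp
  moreover have "card ?V \<le> card E" by (simp add: card_image_le)
  ultimately have card: "card ?V = card E" "aff_dim ?V = int (card ?V) - 1"
    using d by linarith+
  then have inj: "inj_on v E" by (simp add: eq_card_imp_inj_on)
  have indep: "\<not> affine_dependent ?V" using card by (simp add: affine_independent_iff_card)
  \<comment> \<open>Affine dependence is about a set of vectors; as they are distinct, the
    coefficients can be moved from indices to vectors.\<close>
  define c' where "c' x = c (inv_into E v x)" for x
  have c': "c' (v j) = c j" if "j \<in> E" for j using that inj by (simp add: c'_def)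
  have "(\<Sum>j\<in>E. c j) = (\<Sum>j\<in>E. c j *\<^sub>R v j) \<bullet> u"
    by (simp add: inner_sum_left hyp)
  then have "(\<Sum>j\<in>E. c j) = 0" by (simp add: zero)
  then have "sum c' ?V = 0" "(\<Sum>x\<in>?V. c' x *\<^sub>R x) = 0"
    using zero by (simp_all add: sum.reindex[OF inj] c')
  moreover have "v i \<in> ?V" "c' (v i) \<noteq> 0" using i ci by (auto simp: c')
  ultimately have "affine_dependent ?V" 
    unfolding affine_dependent_explicit_finite[OF finite_imageI[OF finite[of E]]] by blast
  then show False using indep by contradiction
qed

lemma sum_block:
  fixes grp :: "'p::finite \<Rightarrow> 'j::finite"
  shows "(\<Sum>k\<in>UNIV. f k) = (\<Sum>j\<in>UNIV. \<Sum>k\<in>block grp j. f k)"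
  using sum.group[of UNIV UNIV grp f] by (simp add: block_def)

lemma weight_matrix_mult [simp]: "(weight_matrix grp w *v s) $ k = w (grp k) * s $ k"
  by (simp add: weight_matrix_def matrix_vector_mult_def if_distrib[where f="\<lambda>x. x * _"] cong: if_cong)

lemma matrix_vector_column: "M *v x = (\<Sum>k\<in>UNIV. x $ k *\<^sub>R column k M)"
  for M :: "real^'p^'m"
  by (simp add: matrix_mult_sum scalar_mult_eq_scaleR)

lemma transpose_mult_nth: "(transpose M *v u) $ k = column k M \<bullet> u"
  for M :: "real^'p^'m"
  by (simp add: matrix_vector_mult_def transpose_def column_def inner_vec_def)

lemma inner_transpose: "(transpose M *v u) \<bullet> x = u \<bullet> (M *v x)"
  for M :: "real^'p^'m"
  by (metis dot_lmul_matrix transpose_matrix_vector)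

locale block_lasso = conjugate_exponents \<alpha> \<alpha>s \<rho>
  for \<alpha> \<alpha>s \<rho> :: real +
  fixes X :: "real^'p^'n" and grp :: "'p \<Rightarrow> 'j::finite" and w :: "'j \<Rightarrow> real" and lam :: real
  assumes w_pos: "\<And>j. 0 < w j" and lam_pos: "0 < lam"
begin

abbreviation "W \<equiv> weight_matrix grp w"
abbreviation "objective \<equiv> block_lasso_objective X grp w \<alpha> lam"
abbreviation "bnorm \<equiv> block_norm grp \<alpha>"
abbreviation "dual_bnorm \<equiv> block_norm grp \<alpha>s"

definition penalty :: "real^'p \<Rightarrow> real" where
  "penalty b = (\<Sum>j\<in>UNIV. w j * bnorm j b)"

text \<open>Subdifferential membership in dual form: \<open>s\<close> lies in the dual unit balls
  and its weighted pairing with \<open>b\<close> attains the penalty. One global equality replaces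
  the distinction between active and inactive blocks; \<open>kkt_block\<close> recovers the
  blockwise form.\<close>

definition kkt :: "real^'n \<Rightarrow> real^'p \<Rightarrow> real^'p \<Rightarrow> bool" where
  "kkt y b s \<longleftrightarrow>
     (1 / real CARD('n)) *\<^sub>R (transpose X *v (X *v b)) + lam *\<^sub>R (W *v s)
       = (1 / real CARD('n)) *\<^sub>R (transpose X *v y) \<and>
     (\<forall>j. dual_bnorm j s \<le> 1) \<and> (W *v s) \<bullet> b = penalty b"

lemma inner_W: "(W *v s) \<bullet> b = (\<Sum>j\<in>UNIV. w j * (\<Sum>k\<in>block grp j. s $ k * b $ k))"
proof -
  have "(W *v s) \<bullet> b = (\<Sum>k\<in>UNIV. w (grp k) * (s $ k * b $ k))"
    by (simp add: inner_vec_def mult.assoc)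
  also have "\<dots> = (\<Sum>j\<in>UNIV. \<Sum>k\<in>block grp j. w (grp k) * (s $ k * b $ k))"
    by (rule sum_block)
  also have "\<dots> = (\<Sum>j\<in>UNIV. w j * (\<Sum>k\<in>block grp j. s $ k * b $ k))"
    by (simp add: sum_distrib_left block_def)
  finally show ?thesis .
qed

lemma W_inj: "W *v s = W *v t \<Longrightarrow> s = t"
  using w_pos by (auto simp: vec_eq_iff) (metis less_irrefl)

lemma block_hoelder: "dual_bnorm j s \<le> 1 \<Longrightarrow> (\<Sum>k\<in>block grp j. s $ k * b $ k) \<le> bnorm j b"
  unfolding block_norm_eq_pnorm by (rule hoelder(1)) auto

lemma inner_W_le_penalty:
  assumes "\<And>j. dual_bnorm j s \<le> 1"
  shows "(W *v s) \<bullet> b \<le> penalty b"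
  unfolding inner_W penalty_def
  using assms w_pos by (intro sum_mono mult_left_mono block_hoelder) (auto intro: less_imp_le)

text \<open>The Hoelder gaps of the blocks are nonnegative and, with positive weights, sum to zero.
  So every gap vanishes, and the case of equality applies to each nonzero block.\<close>

lemma kkt_block:
  assumes kkt: "kkt y b s" and j: "bnorm j b \<noteq> 0"
  shows "dual_bnorm j s = 1" and "\<And>k. grp k = j \<Longrightarrow> b $ k = bnorm j b * eta \<rho> (s $ k)"
proof -
  have le: "\<And>j. dual_bnorm j s \<le> 1" using kkt by (auto simp: kkt_def)
  have "(\<Sum>j\<in>UNIV. w j * (bnorm j b - (\<Sum>k\<in>block grp j. s $ k * b $ k))) = penalty b - (W *v s) \<bullet> b"
    by (simp add: inner_W penalty_def right_diff_distrib sum_subtractf)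
  also have "\<dots> = 0" using kkt by (simp add: kkt_def)
  finally have "\<forall>j\<in>UNIV. w j * (bnorm j b - (\<Sum>k\<in>block grp j. s $ k * b $ k)) = 0"
    using block_hoelder[OF le] w_pos
    by (subst (asm) sum_nonneg_eq_0_iff) (auto intro!: mult_nonneg_nonneg intro: less_imp_le)
  then have "(\<Sum>k\<in>block grp j. s $ k * b $ k) = bnorm j b"
    using w_pos[of j] by (metis UNIV_I eq_iff_diff_eq_0 less_irrefl mult_eq_0_iff)
  note * = hoelder(2)[of "block grp j", OF _ _ this[unfolded block_norm_eq_pnorm], folded block_norm_eq_pnorm, OF _ le j]
  show "dual_bnorm j s = 1" using * by simp
  show "b $ k = bnorm j b * eta \<rho> (s $ k)" if "grp k = j" for k
    using * that by (simp add: block_def)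
qed

lemma bnorm_eq_0_iff: "bnorm j b = 0 \<longleftrightarrow> (\<forall>k. grp k = j \<longrightarrow> b $ k = 0)"
  unfolding block_norm_eq_pnorm using exponents_pos by (subst pnorm_eq_0_iff) (auto simp: block_def)

lemma mem_active_set: "j \<in> active_set grp b \<longleftrightarrow> bnorm j b \<noteq> 0"
  by (auto simp: active_set_def bnorm_eq_0_iff block_def)

lemma penalty_scale: "penalty (c *\<^sub>R b) = \<bar>c\<bar> * penalty b"
proof -
  have "bnorm j (c *\<^sub>R b) = \<bar>c\<bar> * bnorm j b" for j
    unfolding block_norm_eq_pnorm using pnorm_scale[OF exponents_pos(1), of "block grp j" c "($) b"]
    by (simp add: pnorm_cong[of _ "($) (c *\<^sub>R b)" "\<lambda>k. c * b $ k"])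
  then show ?thesis by (simp add: penalty_def sum_distrib_left mult_ac)
qed

lemma penalty_triangle: "penalty (a + b) \<le> penalty a + penalty b"
proof -
  have "bnorm j (a + b) \<le> bnorm j a + bnorm j b" for j
    unfolding block_norm_eq_pnorm using pnorm_triangle[of "block grp j" "($) a" "($) b"]
    by (simp add: pnorm_cong[of _ "($) (a + b)" "\<lambda>k. a $ k + b $ k"])
  then have "penalty (a + b) \<le> (\<Sum>j\<in>UNIV. w j * (bnorm j a + bnorm j b))"
    unfolding penalty_def using w_pos by (intro sum_mono mult_left_mono) (auto intro: less_imp_le)
  then show ?thesis by (simp add: penalty_def distrib_left sum.distrib)
qed

lemma objective_eq: "objective y b = 1 / (2 * real CARD('n)) * (norm (y - X *v b))\<^sup>2 + lam * penalty b"
  by (simp add: block_lasso_objective_def penalty_def)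

text \<open>Stationarity turns the linear term of the quadratic loss into the pairing of W s with
  \<open>d\<close>. Being an exact identity, it serves both the sufficiency and the necessity of the
  optimality conditions.\<close>

lemma objective_diff:
  assumes eq: "(1 / real CARD('n)) *\<^sub>R (transpose X *v (X *v b)) + lam *\<^sub>R (W *v s)
       = (1 / real CARD('n)) *\<^sub>R (transpose X *v y)"
  shows "objective y (b + d) - objective y b =
    1 / (2 * real CARD('n)) * (norm (X *v d))\<^sup>2 - lam * ((W *v s) \<bullet> d) + lam * (penalty (b + d) - penalty b)"
proof -
  let ?n = "real CARD('n)"
  have Ws: "lam *\<^sub>R (W *v s) = (1 / ?n) *\<^sub>R (transpose X *v (y - X *v b))"
    using eq by (simp add: matrix_vector_mult_diff_distrib algebra_simps del: transpose_matrix_vector)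
  have "lam * ((W *v s) \<bullet> d) = (lam *\<^sub>R (W *v s)) \<bullet> d" by simp
  also have "\<dots> = (1 / ?n) * ((y - X *v b) \<bullet> (X *v d))"
    unfolding Ws using inner_transpose[of X "y - X *v b" d] by (simp del: transpose_matrix_vector)
  finally have 1: "lam * ((W *v s) \<bullet> d) = (1 / ?n) * ((y - X *v b) \<bullet> (X *v d))" .
  have "y - X *v (b + d) = (y - X *v b) - X *v d"
    by (simp add: matrix_vector_right_distrib)
  then have "(norm (y - X *v (b + d)))\<^sup>2 =
      (norm (y - X *v b))\<^sup>2 - 2 * ((y - X *v b) \<bullet> (X *v d)) + (norm (X *v d))\<^sup>2"
    by (simp only:) (simp add: power2_norm_eq_inner inner_diff_left inner_diff_right inner_commute)
  moreover have "1 / ?n = 2 * (1 / (2 * ?n))" by simp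
  ultimately show ?thesis unfolding objective_eq 1 by (simp only:) (simp add: algebra_simps)
qed

lemma kkt_imp_minimizer:
  assumes "kkt y b s"
  shows "objective y b \<le> objective y b'"
proof -
  define d where "d = b' - b"
  have "lam * ((W *v s) \<bullet> d) \<le> lam * (penalty b' - penalty b)"
    using assms inner_W_le_penalty[of s b'] lam_pos
    by (intro mult_left_mono) (auto simp: kkt_def d_def inner_diff_right)
  moreover have "objective y (b + d) - objective y b =
    1 / (2 * real CARD('n)) * (norm (X *v d))\<^sup>2 - lam * ((W *v s) \<bullet> d) + lam * (penalty (b + d) - penalty b)"
    using assms by (intro objective_diff) (simp add: kkt_def)
  moreover have "0 \<le> 1 / (2 * real CARD('n)) * (norm (X *v d))\<^sup>2" by simp
  moreover have "b + d = b'" by (simp add: d_def)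
  ultimately show ?thesis by (simp only:)
qed

text \<open>Moving from \<open>b\<close> a fraction t towards a competitor, the loss contributes its
  square only at order t^2. Letting t tend to 0 makes W s a subgradient of the penalty at
  \<open>b\<close>; suitable competitors then give the two dual conditions.\<close>

lemma minimizer_imp_kkt:
  assumes eq: "(1 / real CARD('n)) *\<^sub>R (transpose X *v (X *v b)) + lam *\<^sub>R (W *v s)
       = (1 / real CARD('n)) *\<^sub>R (transpose X *v y)"
    and min: "\<And>b'. objective y b \<le> objective y b'"
  shows "kkt y b s"
proof -
  have variational: "(W *v s) \<bullet> (b' - b) \<le> penalty b' - penalty b" for b'
  proof -
    define d where "d = b' - b"
    define K where "K = 1 / (2 * real CARD('n)) * (norm (X *v d))\<^sup>2"
    define c where "c = lam * ((W *v s) \<bullet> d) - lam * (penalty b' - penalty b)"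
    have small: "c \<le> t * K" if t: "0 < t" "t \<le> 1" for t
    proof -
      have "b + t *\<^sub>R d = (1 - t) *\<^sub>R b + t *\<^sub>R b'" by (simp add: d_def algebra_simps)
      then have "penalty (b + t *\<^sub>R d) \<le> (1 - t) * penalty b + t * penalty b'"
        using penalty_triangle[of "(1 - t) *\<^sub>R b" "t *\<^sub>R b'"] t by (simp add: penalty_scale)
      then have p: "lam * (penalty (b + t *\<^sub>R d) - penalty b) \<le> lam * (t * (penalty b' - penalty b))"
        using lam_pos by (intro mult_left_mono) (auto simp: algebra_simps)
      have "0 \<le> objective y (b + t *\<^sub>R d) - objective y b" using min by simp
      also have "\<dots> = t\<^sup>2 * K - t * (lam * ((W *v s) \<bullet> d)) + lam * (penalty (b + t *\<^sub>R d) - penalty b)"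
        unfolding objective_diff[OF eq]
        by (simp add: K_def matrix_vector_mult_scaleR power_mult_distrib)
      also have "\<dots> \<le> t\<^sup>2 * K - t * c"
        using p by (simp add: c_def algebra_simps)
      finally have "t * c \<le> t * (t * K)" by (simp add: power2_eq_square mult.assoc)
      then show ?thesis using t by simp
    qed
    have "c \<le> 0"
    proof (rule ccontr)
      assume "\<not> c \<le> 0"
      then have c: "0 < c" by simp
      have K: "0 \<le> K" by (simp add: K_def)
      \<comment> \<open>Chosen so that t * K stays below c; the + 1 keeps the denominator positive
        when K = 0.\<close>
      define t where "t = min 1 (c / (2 * (K + 1)))"
      have t: "0 < t" "t \<le> 1" using c K by (auto simp: t_def)
      have "t * K \<le> c / (2 * (K + 1)) * K" using K by (intro mult_right_mono) (auto simp: t_def)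
      also have "\<dots> < c" using c K by (simp add: field_simps add_nonneg_pos)
      finally show False using small[OF t] by simp
    qed
    then have "lam * ((W *v s) \<bullet> d) \<le> lam * (penalty b' - penalty b)" by (simp add: c_def)
    then show ?thesis using lam_pos by (simp add: d_def)
  qed
  \<comment> \<open>By homogeneity of the penalty, the competitors 0 and 2 b give the two
    inequalities of the equality.\<close>
  have "penalty 0 = 0" using penalty_scale[of 0 0] by simp
  then have "penalty b \<le> (W *v s) \<bullet> b" using variational[of 0] by simp
  moreover have "(W *v s) \<bullet> b \<le> penalty b"
    using variational[of "2 *\<^sub>R b"] penalty_scale[of 2 b] by (simp add: scaleR_2)
  ultimately have eq_b: "(W *v s) \<bullet> b = penalty b" by simp
  have dual: "(W *v s) \<bullet> b' \<le> penalty b'" for b'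
    using variational[of b'] eq_b by (simp add: inner_diff_right)
  have "dual_bnorm j s \<le> 1" for j
  proof -
    define q where "q = (\<Sum>k\<in>block grp j. \<bar>s $ k\<bar> powr \<alpha>s)"
    \<comment> \<open>The vector on block \<open>j\<close> for which Hoelder's inequality is sharp.
      Testing with it yields q \<le> q^(1/\<alpha>), which is impossible for q > 1 since \<alpha> >
      1.\<close>
    define b' :: "real^'p" where "b' = (\<chi> k. if grp k = j then eta \<rho> (s $ k) else 0)"
    have b'_in: "(\<Sum>k\<in>block grp i. s $ k * b' $ k) = (if i = j then q else 0)" for i
      by (auto simp: b'_def block_def q_def mult_eta intro!: sum.cong)
    have Wb': "(W *v s) \<bullet> b' = w j * q"
      by (simp add: inner_W b'_in if_distrib cong: if_cong)
    have bnorm_b': "bnorm i b' = (if i = j then q powr (1 / \<alpha>) else 0)" for i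
    proof (cases "i = j")
      case True
      then have "bnorm i b' = pnorm \<alpha> (block grp j) (\<lambda>k. eta \<rho> (s $ k))"
        unfolding block_norm_eq_pnorm by (auto intro!: pnorm_cong simp: b'_def block_def)
      then show ?thesis using True by (simp add: pnorm_eta q_def)
    qed (auto simp: bnorm_eq_0_iff b'_def)
    have "penalty b' = w j * q powr (1 / \<alpha>)"
      by (simp add: penalty_def bnorm_b' if_distrib cong: if_cong)
    then have q: "q \<le> q powr (1 / \<alpha>)" using Wb' dual[of b'] w_pos[of j] by simp
    have "q \<le> 1"
    proof (rule ccontr)
      assume "\<not> q \<le> 1"
      then have "q powr (1 / \<alpha>) < q powr 1" using \<alpha>_gt_1 by (intro powr_less_mono) auto
      then show False using q \<open>\<not> q \<le> 1\<close> by simp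
    qed
    then show ?thesis
      unfolding block_norm_eq_pnorm q_def using exponents_pos by (subst pnorm_le_1_iff) auto
  qed
  then show ?thesis using eq eq_b by (simp add: kkt_def)
qed

section \<open>Continuity, coercivity and existence of a minimizer\<close>

lemma objective_continuous: "continuous_on UNIV (\<lambda>p. objective (fst p) (snd p))"
proof -
  have "continuous_on UNIV (\<lambda>p :: (real^'n) \<times> (real^'p). X *v snd p)"
    by (intro linear_continuous_on_compose[OF _ matrix_vector_mul_linear] continuous_intros)
  moreover have "continuous_on UNIV (\<lambda>p :: (real^'n) \<times> (real^'p). bnorm j (snd p))" for j
    unfolding block_norm_def using exponents_pos
    by (intro continuous_on_powr' continuous_intros ballI) (auto intro: sum_nonneg)
  ultimately show ?thesis unfolding block_lasso_objective_def by (intro continuous_intros)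
qed

text \<open>Coercivity has to come from the penalty, because the loss is constant along the kernel
  of \<open>X\<close>.\<close>

lemma component_le_objective: "lam * w (grp k) * \<bar>b $ k\<bar> \<le> objective y b"
proof -
  have "\<bar>b $ k\<bar> \<le> bnorm (grp k) b"
    unfolding block_norm_eq_pnorm using exponents_pos by (intro abs_le_pnorm) (auto simp: block_def)
  then have "w (grp k) * \<bar>b $ k\<bar> \<le> w (grp k) * bnorm (grp k) b"
    using w_pos[of "grp k"] by (intro mult_left_mono) auto
  also have "\<dots> \<le> penalty b"
    unfolding penalty_def using w_pos
    by (intro member_le_sum[of "grp k" UNIV "\<lambda>j. w j * bnorm j b"])
       (auto simp: block_norm_def less_imp_le)
  finally have "lam * (w (grp k) * \<bar>b $ k\<bar>) \<le> lam * penalty b"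
    using lam_pos by (intro mult_left_mono) auto
  moreover have "0 \<le> 1 / (2 * real CARD('n)) * (norm (y - X *v b))\<^sup>2" by simp
  ultimately show ?thesis unfolding objective_eq by (simp only: mult.assoc)
qed

lemma minimizer_exists: "\<exists>b. \<forall>b'. objective y b \<le> objective y b'"
proof -
  let ?K = "{b. objective y b \<le> objective y 0}"
  have cont: "continuous_on UNIV (objective y)"
    using continuous_on_compose2[OF objective_continuous, of UNIV "\<lambda>b. (y, b)"]
    by (simp add: continuous_on_Pair)
  have "closed ?K"
    by (rule closed_Collect_le[OF cont continuous_on_const])
  moreover have "bounded ?K"
  proof -
    have "norm b \<le> (\<Sum>k\<in>UNIV. objective y 0 / (lam * w (grp k)))" if "b \<in> ?K" for b
    proof -
      have "\<bar>b $ k\<bar> \<le> objective y 0 / (lam * w (grp k))" for k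
        using component_le_objective[of k b y] that lam_pos w_pos[of "grp k"]
        by (simp add: pos_le_divide_eq mult.commute)
      then have "(\<Sum>k\<in>UNIV. \<bar>b $ k\<bar>) \<le> (\<Sum>k\<in>UNIV. objective y 0 / (lam * w (grp k)))"
        by (intro sum_mono)
      then show ?thesis using norm_le_l1_cart[of b] by linarith
    qed
    then show ?thesis by (auto simp: bounded_iff)
  qed
  ultimately have "compact ?K" by (simp add: compact_eq_bounded_closed)
  then obtain b where b: "b \<in> ?K" "\<And>b'. b' \<in> ?K \<Longrightarrow> objective y b \<le> objective y b'"
    using continuous_attains_inf[of ?K "objective y"] continuous_on_subset[OF cont] by blast
  have "objective y b \<le> objective y b'" for b'
    using b(1) b(2)[of b'] by (cases "b' \<in> ?K") auto
  then show ?thesis by blast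
qed

end

section \<open>Uniqueness of the solution\<close>

lemma weight_matrix_inv:
  assumes "\<And>j. w j \<noteq> 0"
  shows "matrix_inv (weight_matrix grp w) ** weight_matrix grp w = mat 1"
proof -
  let ?W = "weight_matrix grp w" and ?V = "weight_matrix grp (\<lambda>j. 1 / w j)"
  have "?W ** ?V = mat 1" "?V ** ?W = mat 1"
    using assms by (simp_all add: matrix_eq matrix_vector_mul_assoc[symmetric] vec_eq_iff)
  then have "?W ** matrix_inv ?W = mat 1 \<and> matrix_inv ?W ** ?W = mat 1"
    unfolding matrix_inv_def by (rule someI[of "\<lambda>V. ?W ** V = mat 1 \<and> V ** ?W = mat 1" ?V, OF conjI])
  then show ?thesis by simp
qed

lemma mult_weight_matrix_nth:
  "(M ** weight_matrix grp w) $ i $ k = M $ i $ k * w (grp k)" for M :: "real^'p^'m"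
  by (simp add: matrix_matrix_mult_def weight_matrix_def if_distrib cong: if_cong)

lemma column_weighted:
  fixes X :: "real^'p^'n"
  assumes "\<And>j. w j \<noteq> 0"
  shows "column k X = w (grp k) *\<^sub>R column k (X ** matrix_inv (weight_matrix grp w))"
proof -
  let ?M = "X ** matrix_inv (weight_matrix grp w)"
  have "?M ** weight_matrix grp w = X"
    using weight_matrix_inv[of w grp] assms by (simp add: matrix_mul_assoc[symmetric])
  then have "X $ i $ k = (?M ** weight_matrix grp w) $ i $ k" for i
    by (simp only:)
  also have "(?M ** weight_matrix grp w) $ i $ k = w (grp k) * ?M $ i $ k" for i
    by (simp add: mult_weight_matrix_nth)
  finally show ?thesis by (simp add: vec_eq_iff column_def)
qed

lemma row_space_eq: "row_space M = range (\<lambda>u. transpose M *v u)"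
  for M :: "real^'p^'n"
proof
  have "subspace (range ((*v) (transpose M)))"
    by (intro linear_subspace_image subspace_UNIV matrix_vector_mul_linear)
  moreover have "row i M \<in> range ((*v) (transpose M))" for i
    using rangeI[of "(*v) (transpose M)" "axis i 1"] unfolding matrix_vector_mult_basis column_transpose .
  then have "rows M \<subseteq> range ((*v) (transpose M))" by (auto simp: rows_def)
  ultimately show "row_space M \<subseteq> range (\<lambda>u. transpose M *v u)"
    unfolding row_space_def by (intro span_minimal) 
  have "transpose M *v u \<in> row_space M" for u
    unfolding row_space_def matrix_vector_column
    by (intro span_sum span_mul span_base) (auto simp: rows_def)
  then show "range (\<lambda>u. transpose M *v u) \<subseteq> row_space M" by auto
qed

lemma subspace_row_space: "subspace (row_space M)" for M :: "real^'p^'n"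
  by (simp add: row_space_def)

text \<open>The definite description in \<open>pinv\<close> calls for uniqueness. For another
  candidate C, the products A B and A C are symmetric and each leaves A fixed, so they coincide;
  multiplying on the left by B cancels A.\<close>

lemma pinv_eqI:
  fixes A :: "real^'b^'a" and B :: "real^'a^'b"
  assumes mp: "is_moore_penrose A B" and left: "B ** A = mat 1"
  shows "pinv A = B"
  unfolding pinv_def
proof (rule the_equality)
  fix C assume C: "is_moore_penrose A C"
  have CA: "C ** A = mat 1"
  proof -
    have "C ** A = (B ** A) ** (C ** A)" by (simp add: left)
    also have "\<dots> = B ** (A ** C ** A)" by (simp add: matrix_mul_assoc)
    also have "\<dots> = mat 1" using C left by (simp add: is_moore_penrose_def)
    finally show ?thesis .
  qed
  have ACA: "A ** C ** A = A" and ABA: "A ** B ** A = A"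
    using C mp by (simp_all add: is_moore_penrose_def)
  have "A ** B = A ** C ** (A ** B)" using ACA by (simp add: matrix_mul_assoc)
  also have "\<dots> = transpose (A ** C) ** transpose (A ** B)"
    using C mp by (simp add: is_moore_penrose_def)
  also have "\<dots> = transpose (A ** B ** (A ** C))" by (rule matrix_transpose_mul[symmetric])
  also have "A ** B ** (A ** C) = A ** C" using ABA by (simp add: matrix_mul_assoc)
  also have "transpose (A ** C) = A ** C" using C by (simp add: is_moore_penrose_def)
  finally have "B ** (A ** C) = B ** (A ** B)" by simp
  then show "C = B" using left by (simp add: matrix_mul_assoc)
qed (fact mp)

text \<open>For injective $X^T$ the matrix $X X^T$ is invertible, since its quadratic form is the
  squared norm of $X^T u$. The pseudo-inverse of $X^T$ is then $(X X^T)^{-1} X$.\<close>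

lemma pinv_transpose_left_inverse:
  fixes X :: "real^'p^'n"
  assumes inj: "\<And>u. transpose X *v u = 0 \<Longrightarrow> u = 0"
  shows "pinv (transpose X) ** transpose X = mat 1"
proof -
  let ?G = "X ** transpose X"
  have "u = 0" if "?G *v u = 0" for u
  proof -
    have "(transpose X *v u) \<bullet> (transpose X *v u) = u \<bullet> (?G *v u)"
      by (simp only: inner_transpose matrix_vector_mul_assoc)
    then show ?thesis using that inj by simp
  qed
  then obtain V where V: "V ** ?G = mat 1"
    using matrix_left_invertible_ker[of ?G] by blast
  then have V': "?G ** V = mat 1" using matrix_left_right_inverse by blast
  have tG: "transpose ?G = ?G" by (simp add: matrix_transpose_mul)
  have "transpose V ** ?G = mat 1"
    using V' tG by (metis matrix_transpose_mul transpose_mat)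
  then have "V = (transpose V ** ?G) ** V" by simp
  also have "\<dots> = transpose V ** (?G ** V)" by (rule matrix_mul_assoc[symmetric])
  also have "\<dots> = transpose V" using V' by simp
  finally have tV: "transpose V = V" ..
  let ?B = "V ** X"
  have left: "?B ** transpose X = mat 1" using V by (simp add: matrix_mul_assoc)
  have "transpose (transpose X ** ?B) = transpose X ** ?B"
    by (simp add: matrix_transpose_mul tV matrix_mul_assoc)
  then have "is_moore_penrose (transpose X) ?B"
    using left unfolding is_moore_penrose_def
    by (metis matrix_mul_assoc matrix_mul_lid matrix_mul_rid transpose_mat)
  then show ?thesis using left pinv_eqI[of "transpose X" ?B] by simp
qed

text \<open>For n \<le> p, any n columns form a basis of the response space, and a vector killed by
  the transpose is orthogonal to all of them.\<close>

lemma columns_independent_transpose_inj: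
  fixes X :: "real^'p^'n"
  assumes "columns_independent X" "CARD('n) \<le> CARD('p)" "transpose X *v u = 0"
  shows "u = 0"
proof -
  obtain C :: "'p set" where C: "card C = CARD('n)"
    using assms(2) by (metis obtain_subset_with_card_n)
  then have "inj_on (\<lambda>k. column k X) C" "independent ((\<lambda>k. column k X) ` C)"
    using assms(1,2) unfolding columns_independent_def by (simp_all add: min_absorb1)
  moreover from this have "card ((\<lambda>k. column k X) ` C) = DIM(real^'n)"
    using C by (simp add: card_image)
  ultimately have "span ((\<lambda>k. column k X) ` C) = UNIV"
    using card_ge_dim_independent[of "(\<lambda>k. column k X) ` C" UNIV] by auto
  moreover have "orthogonal u x" if "x \<in> span ((\<lambda>k. column k X) ` C)" for x
  proof (rule orthogonal_to_span[OF that])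
    fix y assume "y \<in> (\<lambda>k. column k X) ` C"
    then obtain k where "y = column k X" by auto
    then show "orthogonal u y"
      using assms(3) transpose_mult_nth[of X u k]
      by (simp add: orthogonal_def inner_commute)
  qed
  ultimately have "orthogonal u u" by auto
  then show ?thesis by (simp add: orthogonal_def)
qed

locale regular_block_lasso = block_lasso \<alpha> \<alpha>s \<rho> X grp w lam
  for \<alpha> \<alpha>s \<rho> :: real and X :: "real^'p^'n" and grp :: "'p \<Rightarrow> 'j::finite" and w lam +
  assumes dims: "CARD('n) \<le> CARD('p)" and independent: "columns_independent X"
    and bgp: "blockwise_general_position (X ** matrix_inv (weight_matrix grp w)) grp \<alpha>s \<rho>"
begin

abbreviation "M \<equiv> X ** matrix_inv W"

lemma column_X: "column k X = w (grp k) *\<^sub>R column k M"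
  using w_pos by (intro column_weighted) (metis less_irrefl)

text \<open>Dividing each coordinate by its weight turns columns of \<open>X\<close> into columns of
  \<open>M\<close>. The explicit preimage matters: it is the normal vector of the hyperplane used
  for uniqueness.\<close>

lemma subgradient_eq_transpose_M:
  assumes "lam *\<^sub>R (W *v s) = transpose X *v u"
  shows "s = transpose M *v ((1 / lam) *\<^sub>R u)"
proof -
  have "lam * (w (grp k) * s $ k) = w (grp k) * (column k M \<bullet> u)" for k
  proof -
    have "lam * (w (grp k) * s $ k) = (lam *\<^sub>R (W *v s)) $ k" by simp
    also have "\<dots> = column k X \<bullet> u" unfolding assms by (rule transpose_mult_nth)
    finally show ?thesis by (simp add: column_X[of k])
  qed
  then have "s $ k = (1 / lam) * (column k M \<bullet> u)" for k
    using lam_pos w_pos[of "grp k"] by (simp add: field_simps) (metis less_irrefl mult_cancel_left)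
  then show ?thesis
    unfolding vec_eq_iff transpose_mult_nth by simp
qed

lemma kkt_subgradient:
  assumes "kkt y b s"
  shows "s = transpose M *v ((1 / (lam * real CARD('n))) *\<^sub>R (y - X *v b))"
proof -
  have "lam *\<^sub>R (W *v s) = transpose X *v ((1 / real CARD('n)) *\<^sub>R (y - X *v b))"
    using assms
    by (simp add: kkt_def matrix_vector_mult_diff_distrib matrix_vector_mult_scaleR algebra_simps
        del: transpose_matrix_vector)
  from subgradient_eq_transpose_M[OF this] show ?thesis by simp
qed

text \<open>Pairing with \<open>u\<close> turns column k into s_k, and s_k * eta(s_k) =
  |s_k|^\<alpha>s sums to 1 over a saturated block.\<close>

lemma block_vectors_hyperplane:
  assumes s: "s = transpose M *v u" and j: "dual_bnorm j s = 1"
  shows "block_mult grp M j (eta_vec \<rho> s) \<bullet> u = 1"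
proof -
  have "block_mult grp M j (eta_vec \<rho> s) \<bullet> u = (\<Sum>k\<in>block grp j. eta \<rho> (s $ k) * (column k M \<bullet> u))"
    by (simp add: block_mult_def inner_sum_left eta_vec_def)
  also have "\<dots> = (\<Sum>k\<in>block grp j. s $ k * eta \<rho> (s $ k))"
    unfolding s transpose_mult_nth by (simp add: mult.commute)
  also have "\<dots> = 1"
    using j exponents_pos unfolding block_norm_eq_pnorm by (simp add: sum_mult_eta pnorm_eq_1_iff)
  finally show ?thesis .
qed

text \<open>Nonzero blocks are saturated and have direction eta(s). Hence the index set and the
  vectors depend on \<open>s\<close> alone, and solutions sharing \<open>s\<close> differ only in
  the coefficients, the weighted block norms.\<close>

lemma kkt_fit:
  assumes kkt: "kkt y b s"
  shows "X *v b = (\<Sum>j | dual_bnorm j s = 1. (w j * bnorm j b) *\<^sub>R block_mult grp M j (eta_vec \<rho> s))"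
proof -
  have "X *v b = (\<Sum>j\<in>UNIV. \<Sum>k\<in>block grp j. b $ k *\<^sub>R column k X)"
    unfolding matrix_vector_column by (rule sum_block)
  also have "\<dots> = (\<Sum>j\<in>UNIV. (w j * bnorm j b) *\<^sub>R block_mult grp M j (eta_vec \<rho> s))"
  proof (intro sum.cong refl)
    fix j
    show "(\<Sum>k\<in>block grp j. b $ k *\<^sub>R column k X) = (w j * bnorm j b) *\<^sub>R block_mult grp M j (eta_vec \<rho> s)"
    proof (cases "bnorm j b = 0")
      case True
      then show ?thesis by (simp add: bnorm_eq_0_iff block_def)
    next
      case False
      have "b $ k *\<^sub>R column k X = (w j * bnorm j b) *\<^sub>R (eta_vec \<rho> s $ k *\<^sub>R column k M)"
        if "k \<in> block grp j" for k
        using that kkt_block(2)[OF kkt False, of k] column_X[of k]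
        by (simp add: block_def eta_vec_def mult_ac)
      then show ?thesis by (simp add: block_mult_def scaleR_sum_right)
    qed
  qed
  also have "\<dots> = (\<Sum>j | dual_bnorm j s = 1. (w j * bnorm j b) *\<^sub>R block_mult grp M j (eta_vec \<rho> s))"
    using kkt_block(1)[OF kkt] by (intro sum.mono_neutral_right) auto
  finally show ?thesis .
qed

lemma kkt_unique:
  assumes k: "kkt y b s" and k': "kkt y b' s'"
  shows "b = b' \<and> s = s'"
proof -
  let ?n = "real CARD('n)"
  define d where "d = b - b'"
  have eqs: "lam *\<^sub>R (W *v s) = (1 / ?n) *\<^sub>R (transpose X *v (y - X *v b))"
    "lam *\<^sub>R (W *v s') = (1 / ?n) *\<^sub>R (transpose X *v (y - X *v b'))"
    using k k' by (simp_all add: kkt_def matrix_vector_mult_diff_distrib algebra_simps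
      del: transpose_matrix_vector)
  \<comment> \<open>Subtract the stationarity equations and test with d = b - b'. The right-hand
    side becomes -|X d|^2 / n, while the left-hand side is nonnegative because each subgradient
    attains the penalty at its own solution; so X d = 0.\<close>
  have "lam *\<^sub>R (W *v s) - lam *\<^sub>R (W *v s') = - (1 / ?n) *\<^sub>R (transpose X *v (X *v d))"
    unfolding eqs d_def by (simp add: matrix_vector_mult_diff_distrib algebra_simps
      del: transpose_matrix_vector)
  then have "(lam *\<^sub>R (W *v s) - lam *\<^sub>R (W *v s')) \<bullet> d = - (1 / ?n) * ((X *v d) \<bullet> (X *v d))"
    by (simp only: inner_scaleR_left inner_transpose)
  then have "lam * ((W *v s) \<bullet> d - (W *v s') \<bullet> d) = - (1 / ?n) * ((X *v d) \<bullet> (X *v d))"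
    by (simp add: inner_diff_left algebra_simps)
  moreover have "0 \<le> (W *v s) \<bullet> d - (W *v s') \<bullet> d"
    using k k' inner_W_le_penalty[of s b'] inner_W_le_penalty[of s' b]
    by (simp add: kkt_def d_def inner_diff_right)
  then have "0 \<le> lam * ((W *v s) \<bullet> d - (W *v s') \<bullet> d)" using lam_pos by simp
  ultimately have "(X *v d) \<bullet> (X *v d) \<le> 0"
    by (simp add: mult_le_0_iff divide_le_0_iff)
  then have fit: "X *v b = X *v b'"
    by (metis d_def eq_iff_diff_eq_0 inner_eq_zero_iff inner_ge_zero matrix_vector_mult_diff_distrib order_antisym)
  then have "lam *\<^sub>R (W *v s) = lam *\<^sub>R (W *v s')" using eqs by simp
  then have s: "s = s'" using lam_pos W_inj by simp
  define E where "E = {j. dual_bnorm j s = 1}"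
  define v where "v j = block_mult grp M j (eta_vec \<rho> s)" for j
  define u where "u = (1 / (lam * real CARD('n))) *\<^sub>R (y - X *v b)"
  have su: "s = transpose M *v u" unfolding u_def by (rule kkt_subgradient[OF k])
  have "s \<in> row_space M" unfolding row_space_eq su by blast
  then have gp: "general_position E v"
    using bgp unfolding blockwise_general_position_def E_def v_def by blast
  have "(\<Sum>j\<in>E. (w j * bnorm j b - w j * bnorm j b') *\<^sub>R v j) = X *v b - X *v b'"
    using kkt_fit[OF k] kkt_fit[OF k'] by (simp add: s E_def v_def scaleR_diff_left sum_subtractf)
  then have zero: "(\<Sum>j\<in>E. (w j * bnorm j b - w j * bnorm j b') *\<^sub>R v j) = 0" by (simp add: fit)
  \<comment> \<open>Equal fits give a vanishing combination of the saturated vectors, whose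
    independence forces equal norms. Unsaturated blocks vanish in both solutions.\<close>
  have bn: "bnorm j b = bnorm j b'" for j
  proof (cases "j \<in> E")
    case True
    have "w j * bnorm j b - w j * bnorm j b' = 0"
    proof (rule general_position_hyperplane_independent[OF gp _ zero True])
      show "v i \<bullet> u = 1" if "i \<in> E" for i
        using that block_vectors_hyperplane[OF su] by (simp add: E_def v_def)
    qed
    then show ?thesis using w_pos[of j] by simp
  next
    case False
    then have "bnorm j b = 0" "bnorm j b' = 0"
      using kkt_block(1)[OF k, of j] kkt_block(1)[OF k', of j] s by (auto simp: E_def)
    then show ?thesis by simp
  qed
  have "b $ k = b' $ k" for k
  proof (cases "bnorm (grp k) b = 0")
    case True
    then have "bnorm (grp k) b' = 0" using bn by simp
    then show ?thesis using True unfolding bnorm_eq_0_iff by simp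
  next
    case False
    then show ?thesis
      using kkt_block(2)[OF k, of "grp k" k] kkt_block(2)[OF k', of "grp k" k] bn[of "grp k"] s by simp
  qed
  then show ?thesis using s by (simp add: vec_eq_iff)
qed

end

section \<open>The augmented estimator as the inverse of the mapping\<close>

lemma borel_measurable_vec_lambda:
  fixes f :: "'a \<Rightarrow> 'k::finite \<Rightarrow> real"
  assumes "\<And>k. (\<lambda>x. f x k) \<in> borel_measurable N"
  shows "(\<lambda>x. \<chi> k. f x k) \<in> borel_measurable N"
  using assms by (subst borel_measurable_euclidean_space) (auto simp: Basis_vec_def inner_axis)

lemma borel_measurable_vec_nth [measurable (raw)]:
  fixes f :: "'a \<Rightarrow> real^'k"
  assumes "f \<in> borel_measurable N"
  shows "(\<lambda>x. f x $ k) \<in> borel_measurable N"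
  by (rule measurable_compose[OF assms borel_measurable_continuous_onI])
     (intro continuous_on_component continuous_on_id)

lemma borel_measurable_matrix_vector [measurable (raw)]:
  "f \<in> borel_measurable N \<Longrightarrow> (\<lambda>x. Q *v f x) \<in> borel_measurable N" for Q :: "real^'b^'a"
  by (rule measurable_compose[OF _ borel_measurable_continuous_onI])
     (auto intro: linear_continuous_on matrix_vector_mul_bounded_linear)

context regular_block_lasso
begin

definition solution :: "real^'n \<Rightarrow> real^'p" where
  "solution y = (SOME b. \<forall>b'. objective y b \<le> objective y b')"

text \<open>The stationarity equation solved for the subgradient. It makes sense for every
  \<open>b\<close>; only at the minimizer does the result satisfy the dual conditions.\<close>

definition subgradient_of :: "real^'n \<Rightarrow> real^'p \<Rightarrow> real^'p" where
  "subgradient_of y b =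
     (\<chi> k. (1 / (lam * w (grp k))) * ((1 / real CARD('n)) *\<^sub>R (transpose X *v (y - X *v b))) $ k)"

lemma subgradient_of_iff:
  "(1 / real CARD('n)) *\<^sub>R (transpose X *v (X *v b)) + lam *\<^sub>R (W *v s)
     = (1 / real CARD('n)) *\<^sub>R (transpose X *v y) \<longleftrightarrow> s = subgradient_of y b"
proof -
  let ?u = "(1 / real CARD('n)) *\<^sub>R (transpose X *v (y - X *v b))"
  have u: "?u = (1 / real CARD('n)) *\<^sub>R (transpose X *v y) - (1 / real CARD('n)) *\<^sub>R (transpose X *v (X *v b))"
    by (simp add: matrix_vector_mult_diff_distrib scaleR_diff_right del: transpose_matrix_vector)
  have "(1 / real CARD('n)) *\<^sub>R (transpose X *v (X *v b)) + lam *\<^sub>R (W *v s)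
     = (1 / real CARD('n)) *\<^sub>R (transpose X *v y) \<longleftrightarrow> lam *\<^sub>R (W *v s) = ?u"
    unfolding u by (auto simp: algebra_simps simp del: transpose_matrix_vector)
  also have "\<dots> \<longleftrightarrow> (\<forall>k. lam * w (grp k) * s $ k = ?u $ k)"
    by (simp add: vec_eq_iff mult.assoc del: transpose_matrix_vector)
  also have "\<dots> \<longleftrightarrow> (\<forall>k. s $ k = (1 / (lam * w (grp k))) * ?u $ k)"
  proof -
    have "lam * w (grp k) * s $ k = c \<longleftrightarrow> s $ k = (1 / (lam * w (grp k))) * c" for k c
    proof -
      have "lam * w (grp k) \<noteq> 0" using lam_pos w_pos[of "grp k"] by simp
      then show ?thesis by (auto simp: field_simps)
    qed
    then show ?thesis by blast
  qed
  also have "\<dots> \<longleftrightarrow> s = subgradient_of y b"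
    by (simp add: vec_eq_iff subgradient_of_def del: transpose_matrix_vector)
  finally show ?thesis .
qed

lemma minimizer_iff_kkt: "(\<forall>b'. objective y b \<le> objective y b') \<longleftrightarrow> kkt y b (subgradient_of y b)"
  using kkt_imp_minimizer minimizer_imp_kkt subgradient_of_iff by blast

lemma kkt_solution: "kkt y (solution y) (subgradient_of y (solution y))"
  unfolding minimizer_iff_kkt[symmetric] solution_def by (rule someI_ex) (rule minimizer_exists)

lemma solution_iff: "(\<forall>b'. objective y b \<le> objective y b') \<longleftrightarrow> b = solution y"
  using kkt_solution kkt_unique minimizer_iff_kkt by blast

lemma kkt_iff: "kkt y b s \<longleftrightarrow> b = solution y \<and> s = subgradient_of y b"
  using kkt_solution kkt_unique by blast

text \<open>By uniqueness, the graph is the set of pairs that beat every competitor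
  \<open>b'\<close>. Each competitor imposes one closed condition, by joint continuity of the
  objective.\<close>

lemma closed_solution_graph: "closed {p. fst p = solution (snd p)}"
proof -
  have "{p. fst p = solution (snd p)} = (\<Inter>b'. {p. objective (snd p) (fst p) \<le> objective (snd p) b'})"
    unfolding solution_iff[symmetric] by auto
  moreover have "closed {p. objective (snd p) (fst p) \<le> objective (snd p) b'}" for b'
  proof (rule closed_Collect_le)
    show "continuous_on UNIV (\<lambda>p :: (real^'p) \<times> (real^'n). objective (snd p) (fst p))"
      using continuous_on_compose2[OF objective_continuous, of UNIV "\<lambda>p. (snd p, fst p)"]
      by (simp add: continuous_on_Pair continuous_on_fst continuous_on_snd)
    show "continuous_on UNIV (\<lambda>p :: (real^'p) \<times> (real^'n). objective (snd p) b')"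
      using continuous_on_compose2[OF objective_continuous, of UNIV "\<lambda>p. (snd p, b')"]
      by (simp add: continuous_on_Pair continuous_on_snd)
  qed
  ultimately show ?thesis by (simp add: closed_INT)
qed

text \<open>
  Preimages of compact sets are projections, along a compact factor, of closed pieces of the graph.
\<close>

lemma measurable_solution [measurable]: "solution \<in> borel_measurable borel"
proof -
  have closed: "solution -` C \<in> sets borel" if C: "closed C" for C
  proof -
    have "closed {y. \<exists>b. b \<in> C \<inter> cball 0 (real m) \<and> (b, y) \<in> {p. fst p = solution (snd p)}}" for m
      by (rule closed_compact_projection[OF _ closed_solution_graph]) (use C in \<open>auto intro: closed_Int_compact\<close>)
    then have "(\<Union>m. {y. \<exists>b. b \<in> C \<inter> cball 0 (real m) \<and> (b, y) \<in> {p. fst p = solution (snd p)}}) \<in> sets borel"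
      by (intro sets.countable_UN) (auto intro: borel_closed)
    moreover have "solution -` C = (\<Union>m. {y. \<exists>b. b \<in> C \<inter> cball 0 (real m) \<and> (b, y) \<in> {p. fst p = solution (snd p)}})"
      by (auto simp: real_arch_simple)
    ultimately show ?thesis by simp
  qed
  show ?thesis
  proof (rule borel_measurableI)
    fix U :: "(real^'p) set" assume "open U"
    then have "UNIV - solution -` (- U) \<in> sets borel"
      using closed[of "- U"] by (intro sets.Diff) (auto simp: closed_def)
    moreover have "UNIV - solution -` (- U) = solution -` U \<inter> space borel" by auto
    ultimately show "solution -` U \<inter> space borel \<in> sets borel" by simp
  qed
qed

lemma measurable_subgradient_of [measurable]:
  "(\<lambda>y. subgradient_of y (solution y)) \<in> borel_measurable borel"
proof -
  have [measurable]: "(\<lambda>y. transpose X *v (y - X *v solution y)) \<in> borel_measurable borel"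
    by (intro borel_measurable_matrix_vector borel_measurable_diff) measurable
  show ?thesis
    unfolding subgradient_of_def by (rule borel_measurable_vec_lambda) (simp del: transpose_matrix_vector, measurable)
qed

lemma measurable_bnorm [measurable]: "bnorm j \<in> borel_measurable borel"
  unfolding block_norm_def by measurable

text \<open>The coefficient vector coded by \<open>(r, s, A)\<close>, following the form that
  \<open>kkt_block\<close> gives to nonzero blocks.\<close>

definition reconstruct :: "'j set \<Rightarrow> real^'j \<Rightarrow> real^'p \<Rightarrow> real^'p" where
  "reconstruct A r s = (\<chi> k. if grp k \<in> A then r $ grp k * eta \<rho> (s $ k) else 0)"

text \<open>\<open>eta\<close> maps the dual unit sphere of a block to its primal unit sphere, and
  the pairing of s with eta(s) is 1. So on an active block both the norm and the pairing with
  \<open>s\<close> equal r_j.\<close>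

lemma reconstruct:
  assumes r: "r \<in> pos_orthant A" and s: "s \<in> subgrad_set X grp w \<alpha>s A"
  shows bnorm_reconstruct: "bnorm j (reconstruct A r s) = r $ j"
    and inner_reconstruct: "(W *v s) \<bullet> reconstruct A r s = penalty (reconstruct A r s)"
proof -
  have r_out: "r $ j = 0" if "j \<notin> A" for j using r that by (auto simp: pos_orthant_def coord_space_def)
  have r_in: "0 < r $ j" if "j \<in> A" for j using r that by (auto simp: pos_orthant_def)
  have s1: "(\<Sum>k\<in>block grp j. \<bar>s $ k\<bar> powr \<alpha>s) = 1" if "j \<in> A" for j
    using s that exponents_pos unfolding subgrad_set_def block_norm_eq_pnorm
    by (auto simp: pnorm_eq_1_iff)
  show bn: "bnorm j (reconstruct A r s) = r $ j" for j
  proof (cases "j \<in> A")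
    case True
    have "bnorm j (reconstruct A r s) = pnorm \<alpha> (block grp j) (\<lambda>k. r $ j * eta \<rho> (s $ k))"
      unfolding block_norm_eq_pnorm
      by (rule pnorm_cong) (use True in \<open>auto simp: reconstruct_def block_def\<close>)
    also have "\<dots> = r $ j"
      using True r_in[of j] s1[of j] exponents_pos by (simp add: pnorm_scale pnorm_eta)
    finally show ?thesis .
  next
    case False
    then show ?thesis by (auto simp: bnorm_eq_0_iff reconstruct_def r_out)
  qed
  have "(\<Sum>k\<in>block grp j. s $ k * reconstruct A r s $ k) = r $ j" for j
  proof (cases "j \<in> A")
    case True
    then have "(\<Sum>k\<in>block grp j. s $ k * reconstruct A r s $ k) =
        (\<Sum>k\<in>block grp j. r $ j * (s $ k * eta \<rho> (s $ k)))"
      by (intro sum.cong) (auto simp: reconstruct_def block_def mult_ac)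
    then show ?thesis using s1[OF True] by (simp add: sum_distrib_left[symmetric] sum_mult_eta)
  next
    case False
    then show ?thesis by (auto simp: reconstruct_def block_def r_out intro!: sum.neutral)
  qed
  then show "(W *v s) \<bullet> reconstruct A r s = penalty (reconstruct A r s)"
    by (simp add: inner_W penalty_def bn)
qed

lemma subgrad_set_dual_bnorm: "s \<in> subgrad_set X grp w \<alpha>s A \<Longrightarrow> dual_bnorm j s \<le> 1"
  by (cases "j \<in> A") (auto simp: subgrad_set_def)

lemma active_set_reconstruct:
  assumes "r \<in> pos_orthant A" "s \<in> subgrad_set X grp w \<alpha>s A"
  shows "active_set grp (reconstruct A r s) = A"
proof -
  have "j \<in> active_set grp (reconstruct A r s) \<longleftrightarrow> j \<in> A" for j
    unfolding mem_active_set bnorm_reconstruct[OF assms]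
    using assms(1) by (cases "j \<in> A") (auto simp: pos_orthant_def coord_space_def)
  then show ?thesis by blast
qed

text \<open>The converse of \<open>reconstruct\<close>: each optimal pair is coded by a point of the
  sample space, namely the one over its own active set.\<close>

lemma kkt_decompose:
  assumes kkt: "kkt y b s" and A: "A = active_set grp b"
  shows "coords A (block_norms grp \<alpha> b) \<in> pos_orthant A" "s \<in> subgrad_set X grp w \<alpha>s A"
    "reconstruct A (coords A (block_norms grp \<alpha> b)) s = b"
proof -
  have mem: "j \<in> A \<longleftrightarrow> bnorm j b \<noteq> 0" for j unfolding A by (rule mem_active_set)
  have nonneg: "0 \<le> bnorm j b" for j by (simp add: block_norm_def)
  show "coords A (block_norms grp \<alpha> b) \<in> pos_orthant A"
    using mem nonneg by (auto simp: coords_def block_norms_def pos_orthant_def coord_space_def order_less_le)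
  show "s \<in> subgrad_set X grp w \<alpha>s A"
    unfolding subgrad_set_def row_space_eq
    using kkt kkt_subgradient[OF kkt] kkt_block(1)[OF kkt] mem by (auto simp: kkt_def)
  show "reconstruct A (coords A (block_norms grp \<alpha> b)) s = b"
  proof -
    have "reconstruct A (coords A (block_norms grp \<alpha> b)) s $ k = b $ k" for k
    proof (cases "grp k \<in> A")
      case True
      then have "b $ k = bnorm (grp k) b * eta \<rho> (s $ k)"
        using mem by (intro kkt_block(2)[OF kkt]) auto
      then show ?thesis using True by (simp add: reconstruct_def coords_def block_norms_def)
    next
      case False
      then have "b $ k = 0" using mem[of "grp k"] bnorm_eq_0_iff[of "grp k" b] by blast
      then show ?thesis using False by (simp add: reconstruct_def)
    qed
    then show ?thesis by (simp add: vec_eq_iff)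
  qed
qed

section \<open>The mapping and the optimality conditions\<close>

lemma gram_mult: "gram X *v b = (1 / real CARD('n)) *\<^sub>R (transpose X *v (X *v b))"
  by (simp add: gram_def scaleR_matrix_vector_assoc[symmetric] matrix_vector_mul_assoc del: transpose_matrix_vector)

lemma sum_block_mult_reconstruct:
  "(\<Sum>j\<in>A. r $ j *\<^sub>R block_mult grp Q j (eta_vec \<rho> s)) = Q *v reconstruct A r s" for Q :: "real^'p^'m"
proof -
  have "Q *v reconstruct A r s = (\<Sum>j\<in>UNIV. \<Sum>k\<in>block grp j. reconstruct A r s $ k *\<^sub>R column k Q)"
    unfolding matrix_vector_column by (rule sum_block)
  also have "\<dots> = (\<Sum>j\<in>UNIV. if j \<in> A then r $ j *\<^sub>R block_mult grp Q j (eta_vec \<rho> s) else 0)"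
    by (intro sum.cong refl)
       (auto simp: reconstruct_def block_mult_def block_def eta_vec_def scaleR_sum_right intro!: sum.cong)
  finally show ?thesis by (simp add: sum.If_cases)
qed

lemma transpose_X_inj: "transpose X *v u = 0 \<Longrightarrow> u = 0"
  using columns_independent_transpose_inj independent dims by blast

lemma pinv_transpose_X: "pinv (transpose X) *v (transpose X *v u) = u"
proof -
  have "pinv (transpose X) ** transpose X = mat 1"
    using pinv_transpose_left_inverse transpose_X_inj by blast
  then show ?thesis by (simp add: matrix_vector_mul_assoc del: transpose_matrix_vector)
qed

text \<open>This is what the row space condition in the sample space is for: it puts the penalty
  term into the range of $X^T$, next to the Gram terms.\<close>

lemma subgrad_set_range:
  assumes "s \<in> subgrad_set X grp w \<alpha>s A"
  obtains u where "W *v s = transpose X *v u"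
proof -
  obtain u where u: "s = transpose M *v u" using assms unfolding subgrad_set_def row_space_eq by blast
  have "(W *v s) $ k = (transpose X *v u) $ k" for k
    unfolding transpose_mult_nth column_X[of k] weight_matrix_mult u by simp
  then have "W *v s = transpose X *v u" unfolding vec_eq_iff by blast
  then show ?thesis by (rule that)
qed

lemma H_map_eq_iff:
  assumes r: "r \<in> pos_orthant A" and s: "s \<in> subgrad_set X grp w \<alpha>s A"
  shows "H_map X grp w \<rho> A \<beta>\<^sub>0 lam r s = z \<longleftrightarrow>
    kkt (X *v \<beta>\<^sub>0 + sqrt (real CARD('n)) *\<^sub>R z) (reconstruct A r s) s"
proof -
  let ?n = "real CARD('n)"
  let ?b = "reconstruct A r s"
  obtain u where u: "W *v s = transpose X *v u" using subgrad_set_range[OF s] .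
  \<comment> \<open>A preimage under $X^T$ of the bracket in \<open>H_map\<close>, so that the
    mapping equals sqrt n * q. Applying the injective $X^T$ to q = z / sqrt n gives the stationarity
    equation for the response with scaled noise z.\<close>
  define q where "q = (1 / ?n) *\<^sub>R (X *v ?b) + lam *\<^sub>R u - (1 / ?n) *\<^sub>R (X *v \<beta>\<^sub>0)"
  have q: "gram X *v ?b + lam *\<^sub>R (W *v s) - gram X *v \<beta>\<^sub>0 = transpose X *v q"
    unfolding gram_mult u q_def
    by (simp add: matrix_vector_mult_diff_distrib matrix_vector_right_distrib matrix_vector_mult_scaleR
        del: transpose_matrix_vector)
  have "H_map X grp w \<rho> A \<beta>\<^sub>0 lam r s = sqrt ?n *\<^sub>R q"
    unfolding H_map_def sum_block_mult_reconstruct q pinv_transpose_X ..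
  then have "H_map X grp w \<rho> A \<beta>\<^sub>0 lam r s = z \<longleftrightarrow> q = (1 / sqrt ?n) *\<^sub>R z"
    by auto
  also have "\<dots> \<longleftrightarrow> transpose X *v q = transpose X *v ((1 / sqrt ?n) *\<^sub>R z)"
    using pinv_transpose_X by metis
  also have "\<dots> \<longleftrightarrow> gram X *v ?b + lam *\<^sub>R (W *v s) = gram X *v \<beta>\<^sub>0 + (1 / sqrt ?n) *\<^sub>R (transpose X *v z)"
    unfolding q[symmetric]
    by (auto simp: algebra_simps matrix_vector_mult_scaleR simp del: transpose_matrix_vector)
  also have "gram X *v \<beta>\<^sub>0 + (1 / sqrt ?n) *\<^sub>R (transpose X *v z) =
      (1 / ?n) *\<^sub>R (transpose X *v (X *v \<beta>\<^sub>0 + sqrt ?n *\<^sub>R z))"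
  proof -
    have "1 / ?n * sqrt ?n = 1 / sqrt ?n" by (simp add: real_div_sqrt field_simps)
    then show ?thesis
      by (simp add: gram_mult matrix_vector_right_distrib matrix_vector_mult_scaleR scaleR_add_right
          del: transpose_matrix_vector)
  qed
  finally show ?thesis
    unfolding kkt_def gram_mult
    using subgrad_set_dual_bnorm[OF s] inner_reconstruct[OF r s] by blast
qed

lemma inj_on_H_map:
  "inj_on (\<lambda>(r, s). H_map X grp w \<rho> A \<beta>\<^sub>0 lam r s) (pos_orthant A \<times> subgrad_set X grp w \<alpha>s A)"
proof (rule inj_onI, clarify)
  fix r s r' s'
  assume rs: "r \<in> pos_orthant A" "s \<in> subgrad_set X grp w \<alpha>s A"
    "r' \<in> pos_orthant A" "s' \<in> subgrad_set X grp w \<alpha>s A"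
    and eq: "H_map X grp w \<rho> A \<beta>\<^sub>0 lam r s = H_map X grp w \<rho> A \<beta>\<^sub>0 lam r' s'"
  have "reconstruct A r s = reconstruct A r' s' \<and> s = s'"
    using rs eq H_map_eq_iff kkt_unique by metis
  then show "r = r' \<and> s = s'"
    using bnorm_reconstruct rs by (metis vec_eq_iff)
qed

text \<open>A deterministic set of values z of the scaled noise; the factor sqrt n recovers the
  noise in the response. Its probability is therefore the integral of the noise density over
  it.\<close>

definition augmented_event :: "real^'p \<Rightarrow> 'j set \<Rightarrow> (real^'j) set \<Rightarrow> (real^'p) set \<Rightarrow> (real^'n) set" where
  "augmented_event \<beta>\<^sub>0 A \<Gamma> \<Phi> =
     {z. let y = X *v \<beta>\<^sub>0 + sqrt (real CARD('n)) *\<^sub>R z; b = solution y in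
         coords A (block_norms grp \<alpha> b) \<in> \<Gamma> \<and> subgradient_of y b \<in> \<Phi> \<and> active_set grp b = A}"

lemma augmented_event_eq_image:
  assumes "\<Gamma> \<subseteq> pos_orthant A" "\<Phi> \<subseteq> subgrad_set X grp w \<alpha>s A"
  shows "augmented_event \<beta>\<^sub>0 A \<Gamma> \<Phi> = (\<lambda>(r, s). H_map X grp w \<rho> A \<beta>\<^sub>0 lam r s) ` (\<Gamma> \<times> \<Phi>)"
proof (intro set_eqI iffI)
  fix z assume z: "z \<in> augmented_event \<beta>\<^sub>0 A \<Gamma> \<Phi>"
  define y where "y = X *v \<beta>\<^sub>0 + sqrt (real CARD('n)) *\<^sub>R z"
  define b where "b = solution y"
  define s where "s = subgradient_of y b"
  let ?r = "coords A (block_norms grp \<alpha> b)"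
  have mem: "?r \<in> \<Gamma>" "s \<in> \<Phi>" "active_set grp b = A"
    using z by (simp_all add: augmented_event_def Let_def y_def b_def s_def)
  have kkt: "kkt y b s" unfolding b_def s_def by (rule kkt_solution)
  have "H_map X grp w \<rho> A \<beta>\<^sub>0 lam ?r s = z"
    using H_map_eq_iff[of ?r A s \<beta>\<^sub>0 z] kkt_decompose[OF kkt mem(3)[symmetric]] kkt by (simp add: y_def)
  then show "z \<in> (\<lambda>(r, s). H_map X grp w \<rho> A \<beta>\<^sub>0 lam r s) ` (\<Gamma> \<times> \<Phi>)"
    using mem by force
next
  fix z assume "z \<in> (\<lambda>(r, s). H_map X grp w \<rho> A \<beta>\<^sub>0 lam r s) ` (\<Gamma> \<times> \<Phi>)"
  then obtain r s where rs: "r \<in> \<Gamma>" "s \<in> \<Phi>" and z: "H_map X grp w \<rho> A \<beta>\<^sub>0 lam r s = z" by auto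
  define y where "y = X *v \<beta>\<^sub>0 + sqrt (real CARD('n)) *\<^sub>R z"
  have r: "r \<in> pos_orthant A" and s: "s \<in> subgrad_set X grp w \<alpha>s A" using rs assms by auto
  have "kkt y (reconstruct A r s) s" using z H_map_eq_iff[OF r s] by (simp add: y_def)
  then have sol: "solution y = reconstruct A r s" "subgradient_of y (solution y) = s"
    using kkt_iff by metis+
  have "coords A (block_norms grp \<alpha> (solution y)) = r"
    using r by (auto simp: sol(1) vec_eq_iff coords_def block_norms_def bnorm_reconstruct[OF r s]
        pos_orthant_def coord_space_def)
  then show "z \<in> augmented_event \<beta>\<^sub>0 A \<Gamma> \<Phi>"
    using rs sol(2) active_set_reconstruct[OF r s] sol(1)
    by (simp add: augmented_event_def Let_def y_def)
qed

lemma sets_augmented_event: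
  assumes [measurable]: "\<Gamma> \<in> sets borel" "\<Phi> \<in> sets borel"
  shows "augmented_event \<beta>\<^sub>0 A \<Gamma> \<Phi> \<in> sets borel"
proof -
  have [measurable]: "(\<lambda>b. coords A (block_norms grp \<alpha> b)) \<in> borel_measurable borel"
    unfolding coords_def block_norms_def vec_lambda_beta
    by (rule borel_measurable_vec_lambda) measurable
  have "active_set grp b = A \<longleftrightarrow> (\<forall>j. j \<in> A \<longleftrightarrow> bnorm j b \<noteq> 0)" for b
    by (auto simp: set_eq_iff mem_active_set)
  then have [measurable]: "Measurable.pred borel (\<lambda>b. active_set grp b = A)" by simp
  show ?thesis unfolding augmented_event_def Let_def by measurable
qed

end

section \<open>Lebesgue measure on coordinate subspaces\<close>

lemma measurable_extend_by_zero [measurable]: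
  "(\<lambda>u. \<chi> k. if k \<in> F then u k else 0) \<in> (\<Pi>\<^sub>M k\<in>F. lborel) \<rightarrow>\<^sub>M (borel :: (real^'k) measure)"
proof (rule borel_measurable_vec_lambda)
  fix k :: 'k
  show "(\<lambda>u. if k \<in> F then u k else 0) \<in> (\<Pi>\<^sub>M k\<in>F. lborel) \<rightarrow>\<^sub>M (borel :: real measure)"
    by (cases "k \<in> F") (simp_all add: measurable_component_singleton[of _ _ "\<lambda>_. lborel", simplified])
qed

lemma sets_coord_lborel [simp, measurable_cong]: "sets (coord_lborel F) = sets borel"
  by (simp add: coord_lborel_def)

lemma space_coord_lborel [simp]: "space (coord_lborel F) = UNIV"
  by (simp add: coord_lborel_def)

lemma nn_integral_coord_lborel:
  assumes "f \<in> borel_measurable borel"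
  shows "(\<integral>\<^sup>+v. f v \<partial>coord_lborel F) = (\<integral>\<^sup>+u. f (\<chi> k. if k \<in> F then u k else 0) \<partial>(\<Pi>\<^sub>M k\<in>F. lborel))"
  unfolding coord_lborel_def by (rule nn_integral_distr[OF measurable_extend_by_zero]) (simp add: assms)

lemma measurable_coords [measurable]: "coords F \<in> borel_measurable borel"
  unfolding coords_def
proof (rule borel_measurable_vec_lambda)
  fix k show "(\<lambda>v. if k \<in> F then v $ k else 0 :: real) \<in> borel_measurable borel"
    by (cases "k \<in> F") (auto intro!: borel_measurable_vec_nth)
qed

text \<open>The measure sits on the full vector type but is carried by \<open>coord_space F\<close>,
  where \<open>coords F\<close> is the identity.\<close>

lemma nn_integral_coord_lborel_coords:
  assumes [measurable]: "f \<in> borel_measurable borel"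
  shows "(\<integral>\<^sup>+v. f (coords F v) \<partial>coord_lborel F) = (\<integral>\<^sup>+v. f v \<partial>coord_lborel F)"
proof -
  have "coords F (\<chi> k. if k \<in> F then u k else 0) = (\<chi> k. if k \<in> F then u k else 0)" for u
    by (simp add: coords_def vec_eq_iff)
  then show ?thesis by (simp add: nn_integral_coord_lborel)
qed

lemma emeasure_coord_lborel_box:
  assumes "\<And>k. k \<in> F \<Longrightarrow> l k \<le> u k"
  shows "emeasure (coord_lborel F) {v. \<forall>k\<in>F. l k < v $ k \<and> v $ k < u k} = ennreal (\<Prod>k\<in>F. u k - l k)"
proof -
  interpret product_sigma_finite "\<lambda>_ :: 'a. lborel :: real measure"
    by standard
  have "emeasure (coord_lborel F) {v. \<forall>k\<in>F. l k < v $ k \<and> v $ k < u k} =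
      emeasure (\<Pi>\<^sub>M k\<in>F. lborel) ((\<lambda>u. \<chi> k. if k \<in> F then u k else 0) -`
        {v. \<forall>k\<in>F. l k < v $ k \<and> v $ k < u k} \<inter> space (\<Pi>\<^sub>M k\<in>F. lborel))"
    unfolding coord_lborel_def by (rule emeasure_distr[OF measurable_extend_by_zero]) measurable
  also have "(\<lambda>u. \<chi> k. if k \<in> F then u k else 0) -`
        {v. \<forall>k\<in>F. l k < v $ k \<and> v $ k < u k} \<inter> space (\<Pi>\<^sub>M k\<in>F. lborel) =
      (\<Pi>\<^sub>E k\<in>F. {l k<..<u k})"
    by (auto simp: space_PiM PiE_iff)
  also have "emeasure (\<Pi>\<^sub>M k\<in>F. lborel) (\<Pi>\<^sub>E k\<in>F. {l k<..<u k}) = (\<Prod>k\<in>F. emeasure lborel {l k<..<u k})"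
    by (rule emeasure_PiM) simp_all
  also have "\<dots> = (\<Prod>k\<in>F. ennreal (u k - l k))"
    using assms by (intro prod.cong) simp_all
  also have "\<dots> = ennreal (\<Prod>k\<in>F. u k - l k)"
    using assms by (intro prod_ennreal) simp
  finally show ?thesis .
qed

lemma sigma_finite_coord_lborel: "sigma_finite_measure (coord_lborel F)"
proof
  let ?B = "\<lambda>m :: nat. {v :: real^'a. \<forall>k\<in>F. - real m < v $ k \<and> v $ k < real m}"
  have "\<Union> (range ?B) = UNIV"
  proof -
    have "\<exists>m. v \<in> ?B m" for v
    proof -
      obtain m where m: "norm v < real m" using reals_Archimedean2 by blast
      have "\<bar>v $ k\<bar> < real m" for k using component_le_norm_cart[of v k] m by linarith
      then have "v \<in> ?B m" by (simp add: abs_less_iff) (metis minus_less_iff)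
      then show ?thesis by blast
    qed
    then show ?thesis by blast
  qed
  moreover have "emeasure (coord_lborel F) (?B m) \<noteq> \<infinity>" for m
    by (subst emeasure_coord_lborel_box) simp_all
  moreover have "?B m \<in> sets (coord_lborel F)" for m
    unfolding sets_coord_lborel by measurable
  ultimately show "\<exists>C. countable C \<and> C \<subseteq> sets (coord_lborel F) \<and> \<Union> C = space (coord_lborel F) \<and>
      (\<forall>a\<in>C. emeasure (coord_lborel F) a \<noteq> \<infinity>)"
    by (intro exI[of _ "range ?B"]) auto
qed

text \<open>\<open>e\<close> need not reach all of the sum type, so \<open>inv e\<close> is
  meaningful only at labels from \<open>A <+> F\<close>; the case distinction discards its arbitrary
  values elsewhere.\<close>

definition left_part :: "('n \<Rightarrow> 'j + 'p) \<Rightarrow> 'j::finite set \<Rightarrow> real^'n \<Rightarrow> real^'j" where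
  "left_part e A t = (\<chi> j. if j \<in> A then t $ inv e (Inl j) else 0)"

definition right_part :: "('n \<Rightarrow> 'j + 'p) \<Rightarrow> 'p::finite set \<Rightarrow> real^'n \<Rightarrow> real^'p" where
  "right_part e F t = (\<chi> k. if k \<in> F then t $ inv e (Inr k) else 0)"

definition join_parts :: "('n::finite \<Rightarrow> 'j + 'p) \<Rightarrow> (real^'j) \<times> (real^'p) \<Rightarrow> real^'n" where
  "join_parts e p = (\<chi> m. case e m of Inl j \<Rightarrow> fst p $ j | Inr k \<Rightarrow> snd p $ k)"

lemma join_parts_eq_Inl: "e m = Inl j \<Longrightarrow> join_parts e p $ m = fst p $ j"
  and join_parts_eq_Inr: "e m = Inr k \<Longrightarrow> join_parts e p $ m = snd p $ k"
  by (simp_all add: join_parts_def)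

context
  fixes e :: "'n::finite \<Rightarrow> 'j::finite + 'p::finite" and A :: "'j set" and F :: "'p set"
  assumes e: "bij_betw e UNIV (A <+> F)"
begin

lemma inv_e: "inv e (e m) = m" and e_inv_Inl: "j \<in> A \<Longrightarrow> e (inv e (Inl j)) = Inl j"
  and e_inv_Inr: "k \<in> F \<Longrightarrow> e (inv e (Inr k)) = Inr k"
proof -
  show "inv e (e m) = m" using e by (simp add: bij_betw_def)
  have "range e = A <+> F" using e by (simp add: bij_betw_def)
  then show "j \<in> A \<Longrightarrow> e (inv e (Inl j)) = Inl j" "k \<in> F \<Longrightarrow> e (inv e (Inr k)) = Inr k"
    by (auto intro!: f_inv_into_f)
qed

lemma left_part_join: "left_part e A (join_parts e p) = coords A (fst p)"
  by (auto simp: vec_eq_iff left_part_def coords_def join_parts_eq_Inl e_inv_Inl)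

lemma right_part_join: "right_part e F (join_parts e p) = coords F (snd p)"
  by (auto simp: vec_eq_iff right_part_def coords_def join_parts_eq_Inr e_inv_Inr)

lemma e_cases:
  obtains j where "j \<in> A" "e m = Inl j" "m = inv e (Inl j)" | k where "k \<in> F" "e m = Inr k" "m = inv e (Inr k)"
proof -
  have "e m \<in> A <+> F" using e by (auto simp: bij_betw_def)
  then show thesis using that inv_e[of m] by (metis PlusE)
qed

lemma parts_eqI:
  assumes "left_part e A t = left_part e A t'" "right_part e F t = right_part e F t'"
  shows "t = t'"
proof -
  have "t $ m = t' $ m" for m
  proof (cases m rule: e_cases)
    case (1 j)
    then show ?thesis using arg_cong[OF assms(1), of "\<lambda>v. v $ j"] by (simp add: left_part_def)
  next
    case (2 k)
    then show ?thesis using arg_cong[OF assms(2), of "\<lambda>v. v $ k"] by (simp add: right_part_def)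
  qed
  then show ?thesis by (simp add: vec_eq_iff)
qed

lemma parts_join:
  assumes "r \<in> coord_space A" "u \<in> coord_space F"
  shows "left_part e A (join_parts e (r, u)) = r" "right_part e F (join_parts e (r, u)) = u"
  using assms unfolding left_part_join right_part_join by (auto simp: coords_def coord_space_def vec_eq_iff)

lemma sum_parts:
  "(\<Sum>m\<in>UNIV. f (e m) * t $ m) = (\<Sum>j\<in>A. f (Inl j) * left_part e A t $ j) + (\<Sum>k\<in>F. f (Inr k) * right_part e F t $ k)"
  for f :: "'j + 'p \<Rightarrow> real"
proof -
  have "(\<Sum>m\<in>UNIV. f (e m) * t $ m) = (\<Sum>m\<in>UNIV. f (e m) * t $ inv e (e m))"
    by (simp add: inv_e)
  also have "\<dots> = (\<Sum>x\<in>A <+> F. f x * t $ inv e x)"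
    by (rule sum.reindex_bij_betw[OF e])
  finally show ?thesis
    by (simp add: sum.Plus left_part_def right_part_def)
qed

lemma measurable_join_parts [measurable]: "join_parts e \<in> borel \<Otimes>\<^sub>M borel \<rightarrow>\<^sub>M borel"
  unfolding join_parts_def
proof (rule borel_measurable_vec_lambda)
  fix m show "(\<lambda>p. case e m of Inl j \<Rightarrow> fst p $ j | Inr k \<Rightarrow> snd p $ k) \<in> borel \<Otimes>\<^sub>M borel \<rightarrow>\<^sub>M (borel :: real measure)"
    by (cases "e m") (auto intro!: borel_measurable_vec_nth)
qed

text \<open>Through the enumeration, the preimage of a box is a product of two boxes that constrain
  only coordinates in \<open>A\<close> and \<open>F\<close>; their side lengths multiply to those of
  the original box.\<close>

lemma distr_join_parts: "distr (coord_lborel A \<Otimes>\<^sub>M coord_lborel F) borel (join_parts e) = lborel"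
proof (rule lborel_cart_eqI[symmetric])
  fix l u :: "real^'n"
  assume le: "\<And>m. l $ m \<le> u $ m"
  interpret F: sigma_finite_measure "coord_lborel F" by (rule sigma_finite_coord_lborel)
  let ?BA = "{r. \<forall>j\<in>A. l $ inv e (Inl j) < r $ j \<and> r $ j < u $ inv e (Inl j)}"
  let ?BF = "{v. \<forall>k\<in>F. l $ inv e (Inr k) < v $ k \<and> v $ k < u $ inv e (Inr k)}"
  have "join_parts e -` {x. \<forall>m. l $ m < x $ m \<and> x $ m < u $ m} = ?BA \<times> ?BF"
  proof (intro set_eqI iffI)
    fix p assume p: "p \<in> join_parts e -` {x. \<forall>m. l $ m < x $ m \<and> x $ m < u $ m}"
    have "l $ inv e (Inl j) < fst p $ j \<and> fst p $ j < u $ inv e (Inl j)" if "j \<in> A" for j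
      using p join_parts_eq_Inl[of e "inv e (Inl j)" j p] e_inv_Inl[OF that] by (auto dest: spec[of _ "inv e (Inl j)"])
    moreover have "l $ inv e (Inr k) < snd p $ k \<and> snd p $ k < u $ inv e (Inr k)" if "k \<in> F" for k
      using p join_parts_eq_Inr[of e "inv e (Inr k)" k p] e_inv_Inr[OF that] by (auto dest: spec[of _ "inv e (Inr k)"])
    ultimately show "p \<in> ?BA \<times> ?BF" by (simp add: mem_Times_iff)
  next
    fix p assume p: "p \<in> ?BA \<times> ?BF"
    have "l $ m < join_parts e p $ m \<and> join_parts e p $ m < u $ m" for m
      by (cases m rule: e_cases) (use p in \<open>auto simp: mem_Times_iff join_parts_eq_Inl join_parts_eq_Inr\<close>)
    then show "p \<in> join_parts e -` {x. \<forall>m. l $ m < x $ m \<and> x $ m < u $ m}" by simp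
  qed
  then have "emeasure (distr (coord_lborel A \<Otimes>\<^sub>M coord_lborel F) borel (join_parts e))
      {x. \<forall>m. l $ m < x $ m \<and> x $ m < u $ m} = emeasure (coord_lborel A \<Otimes>\<^sub>M coord_lborel F) (?BA \<times> ?BF)"
    by (subst emeasure_distr) (simp_all add: space_pair_measure)
  also have "\<dots> = emeasure (coord_lborel A) ?BA * emeasure (coord_lborel F) ?BF"
    by (rule F.emeasure_pair_measure_Times) simp_all
  also have "\<dots> = ennreal ((\<Prod>j\<in>A. u $ inv e (Inl j) - l $ inv e (Inl j)) * (\<Prod>k\<in>F. u $ inv e (Inr k) - l $ inv e (Inr k)))"
    using le by (simp add: emeasure_coord_lborel_box ennreal_mult prod_nonneg)
  also have "(\<Prod>j\<in>A. u $ inv e (Inl j) - l $ inv e (Inl j)) * (\<Prod>k\<in>F. u $ inv e (Inr k) - l $ inv e (Inr k)) =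
      (\<Prod>x\<in>A <+> F. u $ inv e x - l $ inv e x)"
    by (simp add: prod.Plus)
  also have "\<dots> = (\<Prod>m\<in>UNIV. u $ inv e (e m) - l $ inv e (e m))"
    by (rule prod.reindex_bij_betw[OF e, symmetric])
  finally show "emeasure (distr (coord_lborel A \<Otimes>\<^sub>M coord_lborel F) borel (join_parts e))
      {x. \<forall>m. l $ m < x $ m \<and> x $ m < u $ m} = ennreal (\<Prod>m\<in>UNIV. u $ m - l $ m)"
    by (simp add: inv_e)
qed simp

lemma measurable_left_part [measurable]: "left_part e A \<in> borel_measurable borel"
  unfolding left_part_def
proof (rule borel_measurable_vec_lambda)
  fix k show "(\<lambda>x. if k \<in> A then x $ inv e (Inl k) else 0 :: real) \<in> borel_measurable borel"
    by (cases "k \<in> A") (auto intro!: borel_measurable_vec_nth)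
qed

lemma measurable_right_part [measurable]: "right_part e F \<in> borel_measurable borel"
  unfolding right_part_def
proof (rule borel_measurable_vec_lambda)
  fix k show "(\<lambda>x. if k \<in> F then x $ inv e (Inr k) else 0 :: real) \<in> borel_measurable borel"
    by (cases "k \<in> F") (auto intro!: borel_measurable_vec_nth)
qed

text \<open>Tonelli combined with \<open>distr_join_parts\<close>. Splitting a joined pair returns
  it only up to \<open>coords\<close>, which the two coordinate measures do not notice.\<close>

lemma nn_integral_parts:
  assumes G [measurable]: "(\<lambda>(r, u). G r u) \<in> borel_measurable (borel \<Otimes>\<^sub>M borel)"
  shows "(\<integral>\<^sup>+r. (\<integral>\<^sup>+u. G r u \<partial>coord_lborel F) \<partial>coord_lborel A) =
    (\<integral>\<^sup>+t. G (left_part e A t) (right_part e F t) \<partial>lborel)"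
proof -
  interpret F: sigma_finite_measure "coord_lborel F" by (rule sigma_finite_coord_lborel)
  have [measurable]: "(\<lambda>u. G r u) \<in> borel_measurable borel" for r
    using measurable_compose[OF measurable_Pair1' G, of r] by simp
  have [measurable]: "(\<lambda>r. \<integral>\<^sup>+u. G r u \<partial>coord_lborel F) \<in> borel_measurable borel"
    by (rule F.borel_measurable_nn_integral) measurable
  have "(\<integral>\<^sup>+t. G (left_part e A t) (right_part e F t) \<partial>lborel) =
      (\<integral>\<^sup>+p. G (left_part e A (join_parts e p)) (right_part e F (join_parts e p)) \<partial>(coord_lborel A \<Otimes>\<^sub>M coord_lborel F))"
    by (subst distr_join_parts[symmetric], rule nn_integral_distr) measurable
  also have "\<dots> = (\<integral>\<^sup>+p. (case p of (r, u) \<Rightarrow> G (coords A r) (coords F u)) \<partial>(coord_lborel A \<Otimes>\<^sub>M coord_lborel F))"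
    by (simp add: left_part_join right_part_join case_prod_beta)
  also have "\<dots> = (\<integral>\<^sup>+r. (\<integral>\<^sup>+u. G (coords A r) (coords F u) \<partial>coord_lborel F) \<partial>coord_lborel A)"
    by (subst F.nn_integral_fst[symmetric]) simp_all
  also have "\<dots> = (\<integral>\<^sup>+r. (\<integral>\<^sup>+u. G (coords A r) u \<partial>coord_lborel F) \<partial>coord_lborel A)"
    by (simp add: nn_integral_coord_lborel_coords)
  also have "\<dots> = (\<integral>\<^sup>+r. (\<integral>\<^sup>+u. G r u \<partial>coord_lborel F) \<partial>coord_lborel A)"
    by (rule nn_integral_coord_lborel_coords) measurable
  finally show ?thesis by simp
qed

end

section \<open>The derivative of the mapping\<close>

lemma borel_measurable_eta [measurable]: "eta \<rho> \<in> borel_measurable borel"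
  unfolding eta_def sgn_if by measurable

lemma borel_measurable_eta_deriv [measurable]: "eta_deriv \<rho> \<in> borel_measurable borel"
  unfolding eta_deriv_def by measurable

lemma borel_measurable_block_mult_eta [measurable (raw)]:
  assumes [measurable]: "f \<in> borel_measurable N"
  shows "(\<lambda>x. block_mult grp Q j (eta_vec \<rho> (f x))) \<in> borel_measurable N"
  unfolding block_mult_def eta_vec_def vec_lambda_beta by measurable

lemma borel_measurable_det [measurable (raw)]:
  fixes Q :: "'a \<Rightarrow> real^'n^'n"
  assumes [measurable]: "\<And>i k. (\<lambda>x. Q x $ i $ k) \<in> borel_measurable N"
  shows "(\<lambda>x. det (Q x)) \<in> borel_measurable N"
  unfolding det_def by measurable

lemma borel_measurable_aug_density:
  fixes X :: "real^'p^'n" and grp :: "'p \<Rightarrow> 'j::finite" and fT :: "'a \<Rightarrow> real^'p^'p"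
  assumes [measurable]: "fr \<in> borel_measurable N" "fs \<in> borel_measurable N"
    "\<And>i k. (\<lambda>x. fT x $ i $ k) \<in> borel_measurable N" "g \<in> borel_measurable borel"
  shows "(\<lambda>x. g (H_map X grp w \<rho> A \<beta>\<^sub>0 lam (fr x) (fs x)) * \<bar>jacobian X grp w \<rho> A lam e (fT x) (fr x) (fs x)\<bar>)
    \<in> borel_measurable N"
proof -
  have [measurable]: "(\<lambda>x. H_map X grp w \<rho> A \<beta>\<^sub>0 lam (fr x) (fs x)) \<in> borel_measurable N"
    unfolding H_map_def
    by (intro borel_measurable_scaleR borel_measurable_const borel_measurable_matrix_vector
        borel_measurable_diff borel_measurable_add borel_measurable_sum borel_measurable_block_mult_eta) measurable
  have "(\<lambda>x. M_matrix X grp w \<rho> A lam e (fT x) (fr x) (fs x) $ i $ m) \<in> borel_measurable N" for i m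
    by (cases "e m")
       (simp_all add: M_matrix_def matrix_matrix_mult_def scaled_gram_def D_matrix_def, measurable)
  then have [measurable]: "(\<lambda>x. jacobian X grp w \<rho> A lam e (fT x) (fr x) (fs x)) \<in> borel_measurable N"
    unfolding jacobian_def
    by (intro borel_measurable_det) (simp add: matrix_matrix_mult_def)
  show ?thesis by measurable
qed

section \<open>Derivatives of \<open>eta\<close> and of the mapping\<close>

lemma DERIV_eta:
  assumes "x \<noteq> 0"
  shows "(eta \<rho> has_real_derivative eta_deriv \<rho> x) (at x)"
proof (cases "0 < x")
  case True
  have "((\<lambda>x. x powr \<rho>) has_real_derivative \<rho> * x powr (\<rho> - 1)) (at x)"
    using True by (rule has_real_derivative_powr)
  then have "(eta \<rho> has_real_derivative \<rho> * x powr (\<rho> - 1)) (at x)"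
    by (rule has_field_derivative_transform_within_open[OF _ open_greaterThan[of 0]])
       (use True in \<open>auto simp: eta_def\<close>)
  then show ?thesis using True by (simp add: eta_deriv_def)
next
  case False
  then have x: "x < 0" using assms by simp
  have "((\<lambda>x. - ((- x) powr \<rho>)) has_real_derivative \<rho> * (- x) powr (\<rho> - 1)) (at x)"
    using x by (auto intro!: derivative_eq_intros)
  then have "(eta \<rho> has_real_derivative \<rho> * (- x) powr (\<rho> - 1)) (at x)"
    by (rule has_field_derivative_transform_within_open[OF _ open_lessThan[of 0]])
       (use x in \<open>auto simp: eta_def\<close>)
  then show ?thesis using x by (simp add: eta_deriv_def)
qed

text \<open>
  On a set where \<open>f\<close> vanishes identically, the convention $\eta'(0) = 0$ gives the derivative within
  that set, although \<open>\<eta>\<close> itself is not differentiable at \<open>0\<close> for \<open>\<rho> < 1\<close>.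
\<close>

lemma has_derivative_eta_within:
  assumes f: "(f has_derivative f') (at x within S)" and x: "x \<in> S"
    and zero: "f x = 0 \<Longrightarrow> (\<forall>y\<in>S. f y = 0)"
  shows "((\<lambda>y. eta \<rho> (f y)) has_derivative (\<lambda>h. eta_deriv \<rho> (f x) * f' h)) (at x within S)"
proof -
  consider "f x \<noteq> 0" | "\<rho> = 1" | "f x = 0" "\<rho> \<noteq> 1" by blast
  then show ?thesis
  proof cases
    case 1
    then show ?thesis using DERIV_compose_FDERIV[OF DERIV_eta f] by (simp add: mult.commute)
  next
    case 2
    have "eta 1 y = y" "eta_deriv 1 y = 1" for y by (auto simp: eta_def eta_deriv_def sgn_if)
    then show ?thesis using f 2 by simp
  next
    case 3
    have "((\<lambda>y. 0 :: real) has_derivative (\<lambda>h. 0)) (at x within S)" by simp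
    then have "((\<lambda>y. eta \<rho> (f y)) has_derivative (\<lambda>h. 0)) (at x within S)"
      by (rule has_derivative_transform[OF x, rotated]) (use zero 3 in simp)
    then show ?thesis using 3 by (simp add: eta_deriv_def)
  qed
qed

lemma column_scaled_gram: "column k (scaled_gram X grp r) = r $ grp k *\<^sub>R column k (gram X)"
  by (simp add: vec_eq_iff column_def scaled_gram_def)

lemma D_matrix_mult_nth: "(D_matrix grp \<rho> A s *v v) $ k = (if grp k \<in> A then eta_deriv \<rho> (s $ k) * v $ k else 0)"
  by (simp add: D_matrix_def matrix_vector_mult_def if_distrib[where f="\<lambda>x. x * _"] if_if_eq_conj[symmetric] cong: if_cong)

lemma scaled_gram_D_mult:
  fixes X :: "real^'p^'n" and grp :: "'p \<Rightarrow> 'j::finite"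
  shows "(scaled_gram X grp r ** D_matrix grp \<rho> A s) *v v =
    (\<Sum>j\<in>A. r $ j *\<^sub>R (\<Sum>k\<in>block grp j. (eta_deriv \<rho> (s $ k) * v $ k) *\<^sub>R column k (gram X)))"
proof -
  have "(scaled_gram X grp r ** D_matrix grp \<rho> A s) *v v =
      (\<Sum>j\<in>UNIV. \<Sum>k\<in>block grp j. (D_matrix grp \<rho> A s *v v) $ k *\<^sub>R column k (scaled_gram X grp r))"
    unfolding matrix_vector_mul_assoc[symmetric] matrix_vector_column[of "scaled_gram X grp r"] by (rule sum_block)
  also have "\<dots> = (\<Sum>j\<in>UNIV. if j \<in> A then
      r $ j *\<^sub>R (\<Sum>k\<in>block grp j. (eta_deriv \<rho> (s $ k) * v $ k) *\<^sub>R column k (gram X)) else 0)"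
    by (intro sum.cong refl)
       (auto simp: D_matrix_mult_nth column_scaled_gram block_def scaleR_sum_right mult_ac intro!: sum.cong)
  finally show ?thesis by (simp add: sum.If_cases)
qed

lemma bounded_linear_left_part: "bounded_linear (left_part e A :: real^'n \<Rightarrow> _)"
  unfolding linear_conv_bounded_linear[symmetric] left_part_def by (intro linearI) (auto simp: vec_eq_iff)

lemma bounded_linear_right_part: "bounded_linear (right_part e F :: real^'n \<Rightarrow> _)"
  unfolding linear_conv_bounded_linear[symmetric] right_part_def by (intro linearI) (auto simp: vec_eq_iff)

lemma M_matrix_mult:
  fixes X :: "real^'p^'n" and grp :: "'p \<Rightarrow> 'j::finite"
  assumes e: "bij_betw e UNIV (A <+> F)"
  shows "M_matrix X grp w \<rho> A lam e Ts r s *v h =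
    (\<Sum>j\<in>A. left_part e A h $ j *\<^sub>R block_mult grp (gram X) j (eta_vec \<rho> s)) +
    (scaled_gram X grp r ** D_matrix grp \<rho> A s + lam *\<^sub>R weight_matrix grp w) *v (Ts *v right_part e F h)"
proof -
  let ?Q = "(scaled_gram X grp r ** D_matrix grp \<rho> A s + lam *\<^sub>R weight_matrix grp w) ** Ts"
  have "(M_matrix X grp w \<rho> A lam e Ts r s *v h) $ i =
      (\<Sum>j\<in>A. left_part e A h $ j *\<^sub>R block_mult grp (gram X) j (eta_vec \<rho> s)) $ i + (?Q *v right_part e F h) $ i" for i
  proof -
    have "(M_matrix X grp w \<rho> A lam e Ts r s *v h) $ i =
        (\<Sum>m\<in>UNIV. (case e m of Inl j \<Rightarrow> block_mult grp (gram X) j (eta_vec \<rho> s) $ i | Inr k \<Rightarrow> ?Q $ i $ k) * h $ m)"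
      by (simp add: matrix_vector_mult_def M_matrix_def)
    also have "\<dots> = (\<Sum>j\<in>A. block_mult grp (gram X) j (eta_vec \<rho> s) $ i * left_part e A h $ j) +
        (\<Sum>k\<in>F. ?Q $ i $ k * right_part e F h $ k)"
      by (subst sum_parts[OF e]) simp
    also have "(\<Sum>k\<in>F. ?Q $ i $ k * right_part e F h $ k) = (\<Sum>k\<in>UNIV. ?Q $ i $ k * right_part e F h $ k)"
      by (rule sum.mono_neutral_left) (auto simp: right_part_def)
    also have "\<dots> = (?Q *v right_part e F h) $ i" by (simp add: matrix_vector_mult_def)
    finally show ?thesis by (simp add: mult.commute)
  qed
  then show ?thesis by (simp add: vec_eq_iff matrix_vector_mul_assoc)
qed

text \<open>The product rule explains the columns of \<open>M_matrix\<close>: varying r_j gives the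
  column of group \<open>j\<close>; varying \<open>s\<close> gives the Gram term through
  \<open>D_matrix\<close> and the term lam W through the linear part, both composed with the chart
  derivative \<open>Ts\<close>. The hypothesis \<open>zero\<close> makes \<open>eta\<close>
  differentiable within \<Theta> at vanishing coordinates.\<close>

lemma has_derivative_H_map:
  fixes X :: "real^'p^'n" and grp :: "'p \<Rightarrow> 'j::finite"
  assumes e: "bij_betw e UNIV (A <+> F)"
    and \<sigma>: "(\<sigma> has_derivative (\<lambda>h. Ts *v h)) (at (right_part e F t) within D)"
    and \<Theta>: "t \<in> \<Theta>" "right_part e F ` \<Theta> \<subseteq> D"
    and zero: "\<And>k. \<sigma> (right_part e F t) $ k = 0 \<Longrightarrow> \<forall>t'\<in>\<Theta>. \<sigma> (right_part e F t') $ k = 0"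
  shows "((\<lambda>t. H_map X grp w \<rho> A \<beta>\<^sub>0 lam (left_part e A t) (\<sigma> (right_part e F t))) has_derivative
      (\<lambda>h. (sqrt (real CARD('n)) *\<^sub>R (pinv (transpose X) **
        M_matrix X grp w \<rho> A lam e Ts (left_part e A t) (\<sigma> (right_part e F t)))) *v h)) (at t within \<Theta>)"
proof -
  define s where "s t = \<sigma> (right_part e F t)" for t
  define v where "v h = Ts *v right_part e F h" for h
  have ds: "(s has_derivative v) (at t within \<Theta>)"
  proof -
    have "(right_part e F has_derivative right_part e F) (at t within \<Theta>)"
      by (rule bounded_linear_imp_has_derivative[OF bounded_linear_right_part])
    from diff_chain_within[OF this has_derivative_subset[OF \<sigma> \<Theta>(2)]]
    show ?thesis by (simp add: o_def s_def[abs_def] v_def[abs_def])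
  qed
  have nth: "bounded_linear (\<lambda>x :: real^'q. x $ k)" for k by (rule bounded_linear_vec_nth)
  have dl: "((\<lambda>t. left_part e A t $ j) has_derivative (\<lambda>h. left_part e A h $ j)) (at t within \<Theta>)" for j
    by (rule bounded_linear.has_derivative[OF nth
          bounded_linear_imp_has_derivative[OF bounded_linear_left_part]])
  have deta: "((\<lambda>t. eta \<rho> (s t $ k)) has_derivative (\<lambda>h. eta_deriv \<rho> (s t $ k) * v h $ k)) (at t within \<Theta>)" for k
    by (rule has_derivative_eta_within[OF bounded_linear.has_derivative[OF nth ds] \<Theta>(1)])
       (use zero in \<open>auto simp: s_def\<close>)
  have dblock: "((\<lambda>t. block_mult grp (gram X) j (eta_vec \<rho> (s t))) has_derivative
      (\<lambda>h. \<Sum>k\<in>block grp j. (eta_deriv \<rho> (s t $ k) * v h $ k) *\<^sub>R column k (gram X))) (at t within \<Theta>)" for j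
    unfolding block_mult_def eta_vec_def vec_lambda_beta
    by (intro has_derivative_sum has_derivative_scaleR_left deta)
  have dW: "((\<lambda>t. lam *\<^sub>R (weight_matrix grp w *v s t)) has_derivative (\<lambda>h. lam *\<^sub>R (weight_matrix grp w *v v h))) (at t within \<Theta>)"
    by (intro has_derivative_scaleR_right bounded_linear.has_derivative[OF matrix_vector_mul_bounded_linear ds])
  have dsum: "((\<lambda>t. \<Sum>j\<in>A. left_part e A t $ j *\<^sub>R block_mult grp (gram X) j (eta_vec \<rho> (s t))) has_derivative
      (\<lambda>h. \<Sum>j\<in>A. left_part e A t $ j *\<^sub>R (\<Sum>k\<in>block grp j. (eta_deriv \<rho> (s t $ k) * v h $ k) *\<^sub>R column k (gram X)) +
          left_part e A h $ j *\<^sub>R block_mult grp (gram X) j (eta_vec \<rho> (s t)))) (at t within \<Theta>)"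
    by (intro has_derivative_sum has_derivative_scaleR dl dblock)
  let ?M = "M_matrix X grp w \<rho> A lam e Ts (left_part e A t) (s t)"
  have "((\<lambda>t. (\<Sum>j\<in>A. left_part e A t $ j *\<^sub>R block_mult grp (gram X) j (eta_vec \<rho> (s t))) +
        lam *\<^sub>R (weight_matrix grp w *v s t) - gram X *v \<beta>\<^sub>0) has_derivative (\<lambda>h. ?M *v h)) (at t within \<Theta>)"
  proof (rule has_derivative_eq_rhs)
    show "((\<lambda>t. (\<Sum>j\<in>A. left_part e A t $ j *\<^sub>R block_mult grp (gram X) j (eta_vec \<rho> (s t))) +
        lam *\<^sub>R (weight_matrix grp w *v s t) - gram X *v \<beta>\<^sub>0) has_derivative
        (\<lambda>h. ((\<Sum>j\<in>A. left_part e A t $ j *\<^sub>R (\<Sum>k\<in>block grp j. (eta_deriv \<rho> (s t $ k) * v h $ k) *\<^sub>R column k (gram X)) +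
          left_part e A h $ j *\<^sub>R block_mult grp (gram X) j (eta_vec \<rho> (s t))) +
          lam *\<^sub>R (weight_matrix grp w *v v h)) - 0)) (at t within \<Theta>)"
      by (rule has_derivative_diff[OF has_derivative_add[OF dsum dW] has_derivative_const])
    show "(\<lambda>h. ((\<Sum>j\<in>A. left_part e A t $ j *\<^sub>R (\<Sum>k\<in>block grp j. (eta_deriv \<rho> (s t $ k) * v h $ k) *\<^sub>R column k (gram X)) +
          left_part e A h $ j *\<^sub>R block_mult grp (gram X) j (eta_vec \<rho> (s t))) +
          lam *\<^sub>R (weight_matrix grp w *v v h)) - 0) = (\<lambda>h. ?M *v h)"
      unfolding M_matrix_mult[OF e] matrix_vector_mult_add_rdistrib scaled_gram_D_mult v_def[symmetric]
      by (simp add: sum.distrib scaleR_matrix_vector_assoc[symmetric] add_ac)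
  qed
  then have "((\<lambda>t. sqrt (real CARD('n)) *\<^sub>R (pinv (transpose X) *v
        ((\<Sum>j\<in>A. left_part e A t $ j *\<^sub>R block_mult grp (gram X) j (eta_vec \<rho> (s t))) +
        lam *\<^sub>R (weight_matrix grp w *v s t) - gram X *v \<beta>\<^sub>0))) has_derivative
      (\<lambda>h. sqrt (real CARD('n)) *\<^sub>R (pinv (transpose X) *v (?M *v h)))) (at t within \<Theta>)"
    by (intro has_derivative_scaleR_right bounded_linear.has_derivative[OF matrix_vector_mul_bounded_linear])
  then show ?thesis
    by (simp add: H_map_def s_def scaleR_matrix_vector_assoc[symmetric] matrix_vector_mul_assoc)
qed

section \<open>The distribution of the augmented estimator\<close>

lemma sets_zero_pattern [measurable]: "{s :: real^'p. {k. s $ k = 0} = Z} \<in> sets borel"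
proof -
  have "{s :: real^'p. {k. s $ k = 0} = Z} = {s. \<forall>k. s $ k = 0 \<longleftrightarrow> k \<in> Z}" by auto
  also have "\<dots> \<in> sets borel" by measurable
  finally show ?thesis .
qed

context regular_block_lasso
begin

lemma sets_subgrad_set: "subgrad_set X grp w \<alpha>s A \<in> sets borel"
proof -
  have [measurable]: "dual_bnorm j \<in> borel_measurable borel" for j
    unfolding block_norm_def by measurable
  have [measurable]: "row_space M \<in> sets borel"
    by (intro borel_closed closed_subspace subspace_row_space)
  show ?thesis unfolding subgrad_set_def by measurable
qed

text \<open>The deterministic core: only the chart, the mapping and an integrable \<open>g\<close>
  remain. The event and the parameter set are cut by the same zero patterns, so that the pieces
  correspond under the mapping.\<close>

lemma nn_integral_augmented_event:
  fixes \<sigma> :: "real^'p \<Rightarrow> real^'p" and T :: "real^'p \<Rightarrow> real^'p^'p" and e :: "'n \<Rightarrow> 'j + 'p"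
  assumes g: "\<And>x. 0 \<le> g x" "integrable lborel g"
    and e: "bij_betw e UNIV (A <+> F)"
    and \<Gamma>: "\<Gamma> \<in> sets borel" "\<Gamma> \<subseteq> pos_orthant A"
    and \<Phi>\<^sub>0: "openin (top_of_set (subgrad_set X grp w \<alpha>s A)) \<Phi>\<^sub>0"
    and param: "parameterized_by F \<Phi>\<^sub>0 \<sigma> T"
    and \<Delta>: "\<Delta> \<in> sets borel" "\<Delta> \<subseteq> coords F ` \<Phi>\<^sub>0"
  shows "augmented_event \<beta>\<^sub>0 A \<Gamma> (\<sigma> ` \<Delta>) \<in> sets borel"
    and "(\<integral>\<^sup>+z\<in>augmented_event \<beta>\<^sub>0 A \<Gamma> (\<sigma> ` \<Delta>). ennreal (g z) \<partial>lborel) =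
      (\<integral>\<^sup>+r\<in>\<Gamma>. (\<integral>\<^sup>+u\<in>\<Delta>. ennreal (aug_density g X grp w \<rho> \<beta>\<^sub>0 lam e T A r (\<sigma> u)) \<partial>coord_lborel F) \<partial>coord_lborel A)"
proof -
  let ?D = "coords F ` \<Phi>\<^sub>0"
  let ?l = "left_part e A" and ?r = "right_part e F"
  note [measurable] = \<Gamma>(1) \<Delta>(1) measurable_left_part[OF e] measurable_right_part[OF e]
  have \<sigma>_coords: "\<sigma> (coords F s) = s" if "s \<in> \<Phi>\<^sub>0" for s
    using param that by (simp add: parameterized_by_def)
  have \<sigma>_D: "\<sigma> u \<in> \<Phi>\<^sub>0" "coords F (\<sigma> u) = u" if "u \<in> ?D" for u
    using that \<sigma>_coords by auto
  have der_\<sigma>: "(\<sigma> has_derivative (\<lambda>h. T (\<sigma> u) *v h)) (at u within ?D)" if "u \<in> ?D" for u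
    using param that unfolding parameterized_by_def by blast
  have \<Phi>\<^sub>0_sub: "\<Phi>\<^sub>0 \<subseteq> subgrad_set X grp w \<alpha>s A"
    using \<Phi>\<^sub>0 by (rule openin_imp_subset)
  have [measurable]: "\<Phi>\<^sub>0 \<in> sets borel"
  proof -
    obtain U where "open U" "\<Phi>\<^sub>0 = subgrad_set X grp w \<alpha>s A \<inter> U" using \<Phi>\<^sub>0 by (auto simp: openin_open)
    then show ?thesis using sets_subgrad_set by auto
  qed
  \<comment> \<open>An image under \<sigma> becomes a preimage under the Borel map
    \<open>coords F\<close> within the Borel set \<open>\<Phi>\<^sub>0\<close>; this makes it
    Borel.\<close>
  have image_\<Delta>: "\<sigma> ` \<Delta> = {s \<in> \<Phi>\<^sub>0. coords F s \<in> \<Delta>}"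
    using \<sigma>_D \<Delta>(2) \<sigma>_coords by (auto simp: image_iff subset_iff) (metis \<sigma>_coords)
  have \<sigma>\<Delta>_borel [measurable]: "\<sigma> ` \<Delta> \<in> sets borel" unfolding image_\<Delta> by measurable
  show "augmented_event \<beta>\<^sub>0 A \<Gamma> (\<sigma> ` \<Delta>) \<in> sets borel"
    by (rule sets_augmented_event) measurable

  \<comment> \<open>Outside the chart domain \<sigma> and T are arbitrary and need not be
    measurable. Cutting them off to 0 outside \<Delta> gives Borel functions without changing
    \<open>G\<close>, which contains the indicator of \<Delta>.\<close>
  define \<sigma>' where "\<sigma>' u = indicator \<Delta> u *\<^sub>R \<sigma> u" for u
  define T' where "T' u = indicator \<Delta> u *\<^sub>R T (\<sigma> u)" for u
  have [measurable]: "\<sigma>' \<in> borel_measurable borel"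
    unfolding \<sigma>'_def
  proof (rule borel_measurable_continuous_on_indicator[OF \<Delta>(1)])
    show "continuous_on \<Delta> \<sigma>"
      using der_\<sigma> \<Delta>(2) continuous_on_subset[of ?D \<sigma> \<Delta>]
      by (auto simp: continuous_on_eq_continuous_within intro: has_derivative_continuous)
  qed
  have "T' \<in> borel_measurable borel"
    unfolding T'_def
  proof (rule borel_measurable_continuous_on_indicator[OF \<Delta>(1)])
    show "continuous_on \<Delta> (\<lambda>u. T (\<sigma> u))"
      using param \<Delta>(2) unfolding parameterized_by_def by (meson continuous_on_subset)
  qed
  then have T'_nth [measurable]: "(\<lambda>u. T' u $ i $ k) \<in> borel_measurable borel" for i k
    by (intro measurable_compose[OF _ borel_measurable_continuous_onI, of _ _ "\<lambda>Q. Q $ i $ k"]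
        continuous_on_component continuous_on_id)
  have [measurable]: "g \<in> borel_measurable borel" using g(2) by auto

  define G where "G r u = ennreal (aug_density g X grp w \<rho> \<beta>\<^sub>0 lam e T A r (\<sigma> u)) * indicator \<Delta> u * indicator \<Gamma> r"
    for r u
  have G': "G r u = ennreal (g (H_map X grp w \<rho> A \<beta>\<^sub>0 lam r (\<sigma>' u)) *
      \<bar>jacobian X grp w \<rho> A lam e (T' u) r (\<sigma>' u)\<bar>) * indicator \<Delta> u * indicator \<Gamma> r" for r u
    by (simp add: G_def aug_density_def \<sigma>'_def T'_def split: split_indicator)
  have [measurable]: "(\<lambda>(r, u). G r u) \<in> borel_measurable (borel \<Otimes>\<^sub>M borel)"
  proof -
    have [measurable]: "(\<lambda>p. g (H_map X grp w \<rho> A \<beta>\<^sub>0 lam (fst p) (\<sigma>' (snd p))) *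
        \<bar>jacobian X grp w \<rho> A lam e (T' (snd p)) (fst p) (\<sigma>' (snd p))\<bar>) \<in> borel_measurable (borel \<Otimes>\<^sub>M borel)"
      by (rule borel_measurable_aug_density) measurable
    show ?thesis unfolding G' case_prod_beta by measurable
  qed
  have G_parts [measurable]: "(\<lambda>t. G (?l t) (?r t)) \<in> borel_measurable borel"
    using measurable_compose[of "\<lambda>t. (?l t, ?r t)" borel "borel \<Otimes>\<^sub>M borel" "\<lambda>(r, u). G r u" borel] by simp

  define h where "h t = H_map X grp w \<rho> A \<beta>\<^sub>0 lam (?l t) (\<sigma> (?r t))" for t
  define h' where "h' t v = (sqrt (real CARD('n)) *\<^sub>R (pinv (transpose X) **
      M_matrix X grp w \<rho> A lam e (T (\<sigma> (?r t))) (?l t) (\<sigma> (?r t)))) *v v" for t v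
  define \<Theta> where "\<Theta> Z = {t. ?l t \<in> \<Gamma> \<and> ?r t \<in> \<Delta> \<and> {k. \<sigma> (?r t) $ k = 0} = Z}" for Z
  define \<Phi> where "\<Phi> Z = \<sigma> ` \<Delta> \<inter> {s. {k. s $ k = 0} = Z}" for Z
  have \<Theta>_borel [measurable]: "\<Theta> Z \<in> sets borel" for Z
  proof -
    have "\<Theta> Z = {t. ?l t \<in> \<Gamma> \<and> ?r t \<in> \<Delta> \<and> \<sigma>' (?r t) \<in> {s. {k. s $ k = 0} = Z}}"
      by (auto simp: \<Theta>_def \<sigma>'_def)
    also have "\<dots> \<in> sets borel" by measurable
    finally show ?thesis .
  qed
  have \<Phi>_sub: "\<Phi> Z \<subseteq> subgrad_set X grp w \<alpha>s A" "\<sigma> ` \<Delta> \<subseteq> subgrad_set X grp w \<alpha>s A" for Z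
    using \<Phi>\<^sub>0_sub unfolding \<Phi>_def image_\<Delta> by auto
  have event_borel: "augmented_event \<beta>\<^sub>0 A \<Gamma> (\<Phi> Z) \<in> sets borel" for Z
    unfolding \<Phi>_def by (rule sets_augmented_event) measurable
  have h_image: "h ` \<Theta> Z = augmented_event \<beta>\<^sub>0 A \<Gamma> (\<Phi> Z)" for Z
  proof -
    \<comment> \<open>Every pair is reached because \<Gamma> and \<Delta> lie in the coordinate
      subspaces, where joining and then splitting is the identity.\<close>
    have "(\<lambda>t. (?l t, \<sigma> (?r t))) ` \<Theta> Z = \<Gamma> \<times> \<Phi> Z"
    proof (intro set_eqI iffI)
      fix p assume "p \<in> \<Gamma> \<times> \<Phi> Z"
      then obtain r u where p: "p = (r, \<sigma> u)" "r \<in> \<Gamma>" "u \<in> \<Delta>" "{k. \<sigma> u $ k = 0} = Z"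
        by (auto simp: \<Phi>_def)
      have "r \<in> coord_space A" "u \<in> coord_space F"
        using p \<Gamma>(2) \<Delta>(2) by (auto simp: pos_orthant_def coord_space_def coords_def)
      note parts = parts_join[OF e this]
      have "join_parts e (r, u) \<in> \<Theta> Z" using p by (simp add: \<Theta>_def parts)
      then show "p \<in> (\<lambda>t. (?l t, \<sigma> (?r t))) ` \<Theta> Z"
        by (rule rev_image_eqI) (simp add: p parts)
    qed (auto simp: \<Theta>_def \<Phi>_def)
    then show ?thesis
      unfolding augmented_event_eq_image[OF \<Gamma>(2) \<Phi>_sub(1)]
      by (metis (no_types, lifting) h_def image_cong image_image case_prod_conv)
  qed
  have inj_h: "inj_on h (\<Theta> Z)" for Z
  proof (rule inj_onI)
    fix t t' assume t: "t \<in> \<Theta> Z" "t' \<in> \<Theta> Z" and eq: "h t = h t'"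
    have in_dom: "(?l x, \<sigma> (?r x)) \<in> pos_orthant A \<times> subgrad_set X grp w \<alpha>s A" if "x \<in> \<Theta> Z" for x
      using that \<Gamma>(2) \<Phi>_sub(2) by (auto simp: \<Theta>_def)
    have "(?l t, \<sigma> (?r t)) = (?l t', \<sigma> (?r t'))"
      by (rule inj_onD[OF inj_on_H_map[where \<beta>\<^sub>0 = \<beta>\<^sub>0 and A = A] _ in_dom[OF t(1)] in_dom[OF t(2)]])
         (use eq in \<open>simp add: h_def\<close>)
    then have "?l t = ?l t'" "\<sigma> (?r t) = \<sigma> (?r t')" by auto
    moreover have "?r t \<in> ?D" "?r t' \<in> ?D" using t \<Delta>(2) by (auto simp: \<Theta>_def)
    ultimately show "t = t'" using \<sigma>_D(2) by (intro parts_eqI[OF e]) metis+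
  qed
  \<comment> \<open>On a piece, a coordinate of s that vanishes at one point vanishes at all, which
    is the condition for differentiating \<open>eta\<close>.\<close>
  have der_h: "(h has_derivative h' t) (at t within \<Theta> Z)" if t: "t \<in> \<Theta> Z" for t Z
    unfolding h_def[abs_def] h'_def[abs_def]
  proof (rule has_derivative_H_map[OF e der_\<sigma> t])
    show "?r t \<in> ?D" "?r ` \<Theta> Z \<subseteq> ?D" using t \<Delta>(2) by (auto simp: \<Theta>_def)
    show "\<forall>t'\<in>\<Theta> Z. \<sigma> (?r t') $ k = 0" if "\<sigma> (?r t) $ k = 0" for k
      using t that by (auto simp: \<Theta>_def)
  qed
  have det_h': "\<bar>det (matrix (h' t))\<bar> = \<bar>jacobian X grp w \<rho> A lam e (T (\<sigma> (?r t))) (?l t) (\<sigma> (?r t))\<bar>" for t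
  proof -
    have "matrix (h' t) = sqrt (real CARD('n)) *\<^sub>R (pinv (transpose X) **
      M_matrix X grp w \<rho> A lam e (T (\<sigma> (?r t))) (?l t) (\<sigma> (?r t)))"
      unfolding h'_def[abs_def] by (rule matrix_of_matrix_vector_mul)
    then show ?thesis by (simp only: jacobian_def)
  qed
  have G_h: "ennreal (g (h t) * \<bar>det (matrix (h' t))\<bar>) * indicator (\<Theta> Z) t = G (?l t) (?r t) * indicator (\<Theta> Z) t" for t Z
    by (simp add: G_def aug_density_def h_def det_h' \<Theta>_def split: split_indicator)
  have piece: "(\<integral>\<^sup>+z\<in>augmented_event \<beta>\<^sub>0 A \<Gamma> (\<Phi> Z). ennreal (g z) \<partial>lborel) =
      (\<integral>\<^sup>+t. G (?l t) (?r t) * indicator (\<Theta> Z) t \<partial>lborel)" for Z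
  proof -
    have "(\<integral>\<^sup>+z\<in>h ` \<Theta> Z. ennreal (g z) \<partial>lborel) = (\<integral>\<^sup>+t\<in>\<Theta> Z. ennreal (g (h t) * \<bar>det (matrix (h' t))\<bar>) \<partial>lborel)"
    proof (rule nn_integral_change_of_variables[OF \<Theta>_borel _ der_h inj_h g])
      show "h ` \<Theta> Z \<in> sets borel" unfolding h_image by (rule event_borel)
      show "(\<lambda>t. ennreal (g (h t) * \<bar>det (matrix (h' t))\<bar>) * indicator (\<Theta> Z) t) \<in> borel_measurable borel"
        unfolding G_h by measurable
    qed
    then show ?thesis unfolding h_image G_h .
  qed
  \<comment> \<open>The subgradient belonging to z has exactly one zero pattern, so exactly one
    piece can contain z.\<close>
  have sum_event: "(indicator (augmented_event \<beta>\<^sub>0 A \<Gamma> (\<sigma> ` \<Delta>)) z :: ennreal) =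
      (\<Sum>Z\<in>UNIV. indicator (augmented_event \<beta>\<^sub>0 A \<Gamma> (\<Phi> Z)) z)" for z
  proof -
    define s where "s = subgradient_of (X *v \<beta>\<^sub>0 + sqrt (real CARD('n)) *\<^sub>R z)
        (solution (X *v \<beta>\<^sub>0 + sqrt (real CARD('n)) *\<^sub>R z))"
    have "(indicator (augmented_event \<beta>\<^sub>0 A \<Gamma> (\<Phi> Z)) z :: ennreal) =
        (if Z = {k. s $ k = 0} then indicator (augmented_event \<beta>\<^sub>0 A \<Gamma> (\<sigma> ` \<Delta>)) z else 0)" for Z
      by (auto simp: indicator_def augmented_event_def Let_def s_def \<Phi>_def)
    then show ?thesis by simp
  qed
  have sum_G: "G (?l t) (?r t) = (\<Sum>Z\<in>UNIV. G (?l t) (?r t) * indicator (\<Theta> Z) t)" for t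
  proof (cases "?l t \<in> \<Gamma> \<and> ?r t \<in> \<Delta>")
    case True
    then have "(indicator (\<Theta> Z) t :: ennreal) = (if Z = {k. \<sigma> (?r t) $ k = 0} then 1 else 0)" for Z
      by (auto simp: \<Theta>_def indicator_def)
    then show ?thesis by (simp add: sum_distrib_left[symmetric])
  qed (auto simp: G_def)
  have "(\<integral>\<^sup>+z\<in>augmented_event \<beta>\<^sub>0 A \<Gamma> (\<sigma> ` \<Delta>). ennreal (g z) \<partial>lborel) =
      (\<integral>\<^sup>+z. (\<Sum>Z\<in>UNIV. ennreal (g z) * indicator (augmented_event \<beta>\<^sub>0 A \<Gamma> (\<Phi> Z)) z) \<partial>lborel)"
    by (simp add: sum_event sum_distrib_left)
  also have "\<dots> = (\<Sum>Z\<in>UNIV. \<integral>\<^sup>+z\<in>augmented_event \<beta>\<^sub>0 A \<Gamma> (\<Phi> Z). ennreal (g z) \<partial>lborel)"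
    by (rule nn_integral_sum) (use event_borel in simp)
  also have "\<dots> = (\<Sum>Z\<in>UNIV. \<integral>\<^sup>+t. G (?l t) (?r t) * indicator (\<Theta> Z) t \<partial>lborel)"
    by (simp add: piece)
  also have "\<dots> = (\<integral>\<^sup>+t. (\<Sum>Z\<in>UNIV. G (?l t) (?r t) * indicator (\<Theta> Z) t) \<partial>lborel)"
    by (rule nn_integral_sum[symmetric]) simp
  also have "\<dots> = (\<integral>\<^sup>+t. G (?l t) (?r t) \<partial>lborel)"
    by (simp only: sum_G[symmetric])
  also have "\<dots> = (\<integral>\<^sup>+r. (\<integral>\<^sup>+u. G r u \<partial>coord_lborel F) \<partial>coord_lborel A)"
    by (rule nn_integral_parts[OF e, symmetric]) measurable
  also have "\<dots> = (\<integral>\<^sup>+r\<in>\<Gamma>. (\<integral>\<^sup>+u\<in>\<Delta>. ennreal (aug_density g X grp w \<rho> \<beta>\<^sub>0 lam e T A r (\<sigma> u)) \<partial>coord_lborel F) \<partial>coord_lborel A)"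
    by (intro nn_integral_cong) (simp add: G_def split: split_indicator)
  finally show "(\<integral>\<^sup>+z\<in>augmented_event \<beta>\<^sub>0 A \<Gamma> (\<sigma> ` \<Delta>). ennreal (g z) \<partial>lborel) =
      (\<integral>\<^sup>+r\<in>\<Gamma>. (\<integral>\<^sup>+u\<in>\<Delta>. ennreal (aug_density g X grp w \<rho> \<beta>\<^sub>0 lam e T A r (\<sigma> u)) \<partial>coord_lborel F) \<partial>coord_lborel A)" .
qed

end

theorem theorem3p3:
  fixes X :: "real^'p^'n"
    and grp :: "'p \<Rightarrow> 'j::finite"
    and w :: "'j \<Rightarrow> real"
    and \<alpha> \<alpha>s \<rho> lam sd :: real
    and \<beta>\<^sub>0 :: "real^'p"
    and P :: "'w measure"
    and \<epsilon> y :: "'w \<Rightarrow> real^'n"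
    and g :: "real^'n \<Rightarrow> real"
    and \<beta>hat S :: "'w \<Rightarrow> real^'p"
    and A :: "'j set" and F :: "'p set"
    and e :: "'n \<Rightarrow> 'j + 'p"
    and \<Gamma> :: "(real^'j) set" and \<Phi>\<^sub>0 \<Delta> :: "(real^'p) set"
    and \<sigma> :: "real^'p \<Rightarrow> real^'p" and T :: "real^'p \<Rightarrow> real^'p^'p"
  assumes groups: "surj grp"
    and weights: "\<And>j. 0 < w j"
    and alpha: "1 < \<alpha>" "1 / \<alpha> + 1 / \<alpha>s = 1" "\<rho> = \<alpha>s / \<alpha>"
    and dims: "CARD('n) \<le> CARD('p)"
    and lam: "0 < lam"
    and assumption1: "columns_independent X"
    and assumption2a: "\<And>j. card (block grp j) \<le> CARD('n)"
    and assumption2b: "blockwise_general_position (X ** matrix_inv (weight_matrix grp w)) grp \<alpha>s \<rho>"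
    and prob: "prob_space P"
    and indep: "prob_space.indep_vars P (\<lambda>_. borel) (\<lambda>i \<omega>. \<epsilon> \<omega> $ i) UNIV"
    and ident: "\<And>i i'. distr P borel (\<lambda>\<omega>. \<epsilon> \<omega> $ i) = distr P borel (\<lambda>\<omega>. \<epsilon> \<omega> $ i')"
    and mean: "\<And>i. integrable P (\<lambda>\<omega>. \<epsilon> \<omega> $ i)" "\<And>i. prob_space.expectation P (\<lambda>\<omega>. \<epsilon> \<omega> $ i) = 0"
    and var: "\<And>i. integrable P (\<lambda>\<omega>. (\<epsilon> \<omega> $ i)\<^sup>2)" "\<And>i. prob_space.variance P (\<lambda>\<omega>. \<epsilon> \<omega> $ i) = sd\<^sup>2"
    and g_nonneg: "\<And>x. 0 \<le> g x"
    and g_density: "distributed P lborel (\<lambda>\<omega>. (1 / sqrt (real CARD('n))) *\<^sub>R \<epsilon> \<omega>) (\<lambda>x. ennreal (g x))"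
    and model: "\<And>\<omega>. \<omega> \<in> space P \<Longrightarrow> y \<omega> = X *v \<beta>\<^sub>0 + \<epsilon> \<omega>"
    and lasso: "\<And>\<omega>. \<omega> \<in> space P \<Longrightarrow>
          is_arg_min (block_lasso_objective X grp w \<alpha> lam (y \<omega>)) (\<lambda>_. True) (\<beta>hat \<omega>)"
    and subgradient: "\<And>\<omega>. \<omega> \<in> space P \<Longrightarrow>
          (1 / real CARD('n)) *\<^sub>R (transpose X *v (X *v \<beta>hat \<omega>)) + lam *\<^sub>R (weight_matrix grp w *v S \<omega>)
            = (1 / real CARD('n)) *\<^sub>R (transpose X *v y \<omega>)"
    and card_A: "card A \<le> CARD('n)"
    and card_F: "card F = CARD('n) - card A"
    and enum: "bij_betw e UNIV (A <+> F)"
    and Gamma: "\<Gamma> \<in> sets borel" "\<Gamma> \<subseteq> pos_orthant A"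
    and Phi0: "openin (top_of_set (subgrad_set X grp w \<alpha>s A)) \<Phi>\<^sub>0"
    and param: "parameterized_by F \<Phi>\<^sub>0 \<sigma> T"
    and Delta: "\<Delta> \<in> sets borel" "\<Delta> \<subseteq> coords F ` \<Phi>\<^sub>0"
  shows "{\<omega> \<in> space P. coords A (block_norms grp \<alpha> (\<beta>hat \<omega>)) \<in> \<Gamma> \<and> S \<omega> \<in> \<sigma> ` \<Delta>
            \<and> active_set grp (\<beta>hat \<omega>) = A} \<in> sets P
       \<and> emeasure P {\<omega> \<in> space P. coords A (block_norms grp \<alpha> (\<beta>hat \<omega>)) \<in> \<Gamma> \<and> S \<omega> \<in> \<sigma> ` \<Delta>
            \<and> active_set grp (\<beta>hat \<omega>) = A}
         = (\<integral>\<^sup>+ r\<in>\<Gamma>. (\<integral>\<^sup>+ u\<in>\<Delta>. ennreal (aug_density g X grp w \<rho> \<beta>\<^sub>0 lam e T A r (\<sigma> u))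
              \<partial>coord_lborel F) \<partial>coord_lborel A)"
proof -
  interpret regular_block_lasso \<alpha> \<alpha>s \<rho> X grp w lam
    by unfold_locales (fact alpha weights lam dims assumption1 assumption2b)+
  interpret P: prob_space P by (fact prob)
  let ?Z = "\<lambda>\<omega>. (1 / sqrt (real CARD('n))) *\<^sub>R \<epsilon> \<omega>"
  let ?E = "{\<omega> \<in> space P. coords A (block_norms grp \<alpha> (\<beta>hat \<omega>)) \<in> \<Gamma> \<and> S \<omega> \<in> \<sigma> ` \<Delta>
            \<and> active_set grp (\<beta>hat \<omega>) = A}"
  let ?L = "augmented_event \<beta>\<^sub>0 A \<Gamma> (\<sigma> ` \<Delta>)"
  have g_meas: "g \<in> borel_measurable borel"
    using distributed_real_measurable[OF _ g_density] g_nonneg by simp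
  \<comment> \<open>Total mass one supplies the integrability of \<open>g\<close> required by the
    change of variables.\<close>
  have "(\<integral>\<^sup>+x. ennreal (g x) \<partial>lborel) = emeasure P (?Z -` UNIV \<inter> space P)"
    using distributed_emeasure[OF g_density, of UNIV] by simp
  also have "\<dots> = 1" by (simp add: P.emeasure_space_1)
  finally have g_int: "integrable lborel g"
    using g_meas g_nonneg by (intro integrableI_nonneg) auto
  note event = nn_integral_augmented_event[OF g_nonneg g_int enum Gamma Phi0 param Delta, where \<beta>\<^sub>0 = \<beta>\<^sub>0]
  \<comment> \<open>Pointwise in \<omega>, the given estimator and subgradient are the functions
    \<open>solution\<close> and \<open>subgradient_of\<close> of the response, so randomness enters
    only through the scaled noise.\<close>
  have E: "?E = ?Z -` ?L \<inter> space P"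
  proof -
    have "(coords A (block_norms grp \<alpha> (\<beta>hat \<omega>)) \<in> \<Gamma> \<and> S \<omega> \<in> \<sigma> ` \<Delta> \<and> active_set grp (\<beta>hat \<omega>) = A) \<longleftrightarrow>
        ?Z \<omega> \<in> ?L" if \<omega>: "\<omega> \<in> space P" for \<omega>
    proof -
      have y: "X *v \<beta>\<^sub>0 + sqrt (real CARD('n)) *\<^sub>R ?Z \<omega> = y \<omega>"
        using model[OF \<omega>] by simp
      have "\<forall>b'. objective (y \<omega>) (\<beta>hat \<omega>) \<le> objective (y \<omega>) b'"
        using lasso[OF \<omega>] by (simp add: is_arg_min_def not_less)
      then have b: "\<beta>hat \<omega> = solution (y \<omega>)" unfolding solution_iff .
      have s: "S \<omega> = subgradient_of (y \<omega>) (\<beta>hat \<omega>)"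
        using subgradient[OF \<omega>] unfolding subgradient_of_iff .
      show ?thesis unfolding augmented_event_def mem_Collect_eq y Let_def by (simp add: s b)
    qed
    then show ?thesis by blast
  qed
  have "?E \<in> sets P"
    unfolding E using distributed_measurable[OF g_density] event(1) by (intro measurable_sets) auto
  moreover have "emeasure P ?E = (\<integral>\<^sup>+z\<in>?L. ennreal (g z) \<partial>lborel)"
    unfolding E using event(1) by (intro distributed_emeasure[OF g_density]) simp
  ultimately show ?thesis unfolding event(2) by blast
qed

end
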